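(* Let $\ell=(l_1,\ldots,l_r)\in(\mathbb{Z}_{\ge0})^r$, write $N(\mathbf{x};\ell)=\sum_{\lambda\in\Lambda}a_\lambda\mathbf{x}^\lambda$, let $\theta=\rho+\sum_{k=1}^r l_k\varpi_k$, and let $\Pi=\Pi_\theta$ be the convex hull in $\Lambda\otimes\mathbb{R}$ of the points $\theta-w\theta$, $w\in W$. Then the support $$\operatorname{Supp}N(\mathbf{x};\ell)=\{\lambda\in\Lambda\mid a_\lambda\neq0\}$$ is contained in the polytope $\Pi$.
   Context: Let $\Phi$ be a simply-laced reduced root system of rank $r$ with Weyl group $W$, a fixed decomposition $\Phi=\Phi^+\cup\Phi^-$ into positive and negative roots, simple roots $\alpha_1,\ldots,\alpha_r$ and corresponding simple reflections $\sigma_1,\ldots,\sigma_r\in W$. Indices $i\ne j$ are adjacent if the corresponding nodes of the Dynkin diagram are adjacent. Let $\varpi_1,\ldots,\varpi_r$ be the fundamental weights (the dual basis to the simple roots with respect to the $W$-invariant scalar product $\langle\cdot,\cdot\rangle$ normalized so that $\langle\alpha,\alpha\rangle=2$ for roots $\alpha$), and $\rho=\frac12\sum_{\alpha\in\Phi^+}\alpha=\sum_i\varpi_i$. Let $\Lambda$ be the root lattice, and for $\lambda=\sum_i k_i\alpha_i\in\Lambda$ put $d(\lambda)=\sum_i k_i$ and $\mathbf{x}^\lambda=x_1^{k_1}\cdots x_r^{k_r}$. Fix a prime power $q$, with $\sqrt q>0$, and let $F=\mathbb{C}(x_1,\ldots,x_r)$, $\mathbf{x}=(x_1,\ldots,x_r)$.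 Define $\sigma_i\mathbf{x}=\mathbf{x}'$ by $x_j'=x_ix_j\sqrt q$ if $i$ and $j$ are adjacent, $x_j'=1/(qx_j)$ if $j=i$, and $x_j'=x_j$ otherwise; this extends to an action of $W$ on $\mathbf{x}$, written $w\mathbf{x}$. Define $\epsilon_i\mathbf{x}=\mathbf{x}'$ by $x_j'=-x_j$ if $i$ and $j$ are adjacent and $x_j'=x_j$ otherwise. For $f\in F$ set $$f^{\pm}_{i,\ell}(\mathbf{x})=\frac{f(\mathbf{x})\pm(-1)^{l_i}f(\epsilon_i\mathbf{x})}{2},$$ $$(f|_\ell\sigma_i)(\mathbf{x})=-\frac{1-qx_i}{qx_i(1-x_i)}(x_i\sqrt q)^{l_i}f^+_{i,\ell}(\sigma_i\mathbf{x})+\frac{1}{x_i\sqrt q}(x_i\sqrt q)^{l_i}f^-_{i,\ell}(\sigma_i\mathbf{x}).$$ This extends to a (right) action $f\mapsto f|_\ell w$ of $W$ on $F$, i.e. $f|_\ell(ww')=(f|_\ell w)|_\ell w'$. Define $$\Delta(\mathbf{x})=\prod_{\alpha\in\Phi^+}(1-q^{d(\alpha)}\mathbf{x}^{2\alpha}),\qquad j(w,\mathbf{x})=\Delta(\mathbf{x})/\Delta(w\mathbf{x})=\operatorname{sgn}(w)\,q^{d(\rho-w^{-1}\rho)}\mathbf{x}^{2(\rho-w^{-1}\rho)},$$ $$f(\mathbf{x};\ell)=\Delta(\mathbf{x})^{-1}\sum_{w\in W}j(w,\mathbf{x})\,(1|_\ell w)(\mathbf{x}),\qquad D(\mathbf{x})=\prod_{\alpha\in\Phi^+}(1-q^{d(\alpha)-1}\mathbf{x}^{2\alpha}),$$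 and $N(\mathbf{x};\ell)=D(\mathbf{x})f(\mathbf{x};\ell)$, which is a polynomial in $x_1,\ldots,x_r$. *)

theory Defs
  imports
    "HOL-Analysis.Analysis"
    "HOL-Library.Poly_Mapping"
    "HOL-Computational_Algebra.Fraction_Field"
    "HOL-Number_Theory.Prime_Powers"
begin

section \<open>Root systems\<close>

text \<open>
  The ambient Euclidean space \<open>'a\<close> is \<open>\<Lambda> \<otimes> \<real>\<close>, and its inner product is
  the \<open>W\<close>-invariant scalar product. The simple roots are a family indexed by a finite type \<open>'r\<close>,
  so that the rank is \<open>CARD('r) = DIM('a)\<close>.
\<close>

definition reflection :: "'a::euclidean_space \<Rightarrow> 'a \<Rightarrow> 'a" where
  "reflection \<alpha> v = v - (2 * (v \<bullet> \<alpha>) / (\<alpha> \<bullet> \<alpha>)) *\<^sub>R \<alpha>"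

definition root_system :: "'a::euclidean_space set \<Rightarrow> bool" where
  "root_system \<Phi> \<longleftrightarrow>
     finite \<Phi> \<and> 0 \<notin> \<Phi> \<and> span \<Phi> = UNIV \<and>
     (\<forall>\<alpha>\<in>\<Phi>. \<forall>\<beta>\<in>\<Phi>. reflection \<alpha> \<beta> \<in> \<Phi>) \<and>
     (\<forall>\<alpha>\<in>\<Phi>. \<forall>\<beta>\<in>\<Phi>. 2 * (\<beta> \<bullet> \<alpha>) / (\<alpha> \<bullet> \<alpha>) \<in> \<int>)"

definition reduced_roots :: "'a::euclidean_space set \<Rightarrow> bool" where
  "reduced_roots \<Phi> \<longleftrightarrow> (\<forall>\<alpha>\<in>\<Phi>. \<forall>c. c *\<^sub>R \<alpha> \<in> \<Phi> \<longrightarrow> c = 1 \<or> c = -1)"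

definition simply_laced :: "'a::euclidean_space set \<Rightarrow> bool" where
  "simply_laced \<Phi> \<longleftrightarrow>
     (\<forall>\<alpha>\<in>\<Phi>. \<forall>\<beta>\<in>\<Phi>. \<beta> \<noteq> \<alpha> \<longrightarrow> \<beta> \<noteq> - \<alpha> \<longrightarrow> 2 * (\<beta> \<bullet> \<alpha>) / (\<alpha> \<bullet> \<alpha>) \<in> {-1, 0, 1})"

definition normalized_roots :: "'a::euclidean_space set \<Rightarrow> bool" where
  "normalized_roots \<Phi> \<longleftrightarrow> (\<forall>\<alpha>\<in>\<Phi>. \<alpha> \<bullet> \<alpha> = 2)"

definition pos_roots :: "'a::euclidean_space set \<Rightarrow> ('r::finite \<Rightarrow> 'a) \<Rightarrow> 'a set" where
  "pos_roots \<Phi> \<alpha> = {\<beta>\<in>\<Phi>. \<exists>k::'r \<Rightarrow> nat. \<beta> = (\<Sum>i\<in>UNIV. real (k i) *\<^sub>R \<alpha> i)}"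

text \<open>
  Fixing a system of simple roots is the same as fixing a decomposition of \<open>\<Phi>\<close> into positive
  and negative roots; the positive roots are then those in \<^const>\<open>pos_roots\<close>.
\<close>

definition simple_roots :: "'a::euclidean_space set \<Rightarrow> ('r::finite \<Rightarrow> 'a) \<Rightarrow> bool" where
  "simple_roots \<Phi> \<alpha> \<longleftrightarrow>
     inj \<alpha> \<and> range \<alpha> \<subseteq> \<Phi> \<and> independent (range \<alpha>) \<and>
     (\<forall>\<beta>\<in>\<Phi>. \<beta> \<in> pos_roots \<Phi> \<alpha> \<or> - \<beta> \<in> pos_roots \<Phi> \<alpha>)"

inductive_set weyl_group :: "'a::euclidean_space set \<Rightarrow> ('a \<Rightarrow> 'a) set"
  for \<Phi> :: "'a set" where
  one: "id \<in> weyl_group \<Phi>"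
| refl: "\<alpha> \<in> \<Phi> \<Longrightarrow> w \<in> weyl_group \<Phi> \<Longrightarrow> reflection \<alpha> \<circ> w \<in> weyl_group \<Phi>"

definition adjacent :: "('r \<Rightarrow> 'a::euclidean_space) \<Rightarrow> 'r \<Rightarrow> 'r \<Rightarrow> bool" where
  "adjacent \<alpha> i j \<longleftrightarrow> i \<noteq> j \<and> \<alpha> i \<bullet> \<alpha> j \<noteq> 0"

definition fund_weight :: "('r \<Rightarrow> 'a::euclidean_space) \<Rightarrow> 'r \<Rightarrow> 'a" where
  "fund_weight \<alpha> i = (THE v. \<forall>j. v \<bullet> \<alpha> j = (if j = i then 1 else 0))"

definition rho :: "'a::euclidean_space set \<Rightarrow> ('r::finite \<Rightarrow> 'a) \<Rightarrow> 'a" where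
  "rho \<Phi> \<alpha> = (1/2) *\<^sub>R (\<Sum>\<beta>\<in>pos_roots \<Phi> \<alpha>. \<beta>)"

definition root_lattice :: "('r::finite \<Rightarrow> 'a::euclidean_space) \<Rightarrow> 'a set" where
  "root_lattice \<alpha> = {v. \<exists>k::'r \<Rightarrow> int. v = (\<Sum>i\<in>UNIV. of_int (k i) *\<^sub>R \<alpha> i)}"

definition root_coord :: "('r::finite \<Rightarrow> 'a::euclidean_space) \<Rightarrow> 'a \<Rightarrow> 'r \<Rightarrow> int" where
  "root_coord \<alpha> v = (THE k. v = (\<Sum>i\<in>UNIV. of_int (k i) *\<^sub>R \<alpha> i))"

definition root_height :: "('r::finite \<Rightarrow> 'a::euclidean_space) \<Rightarrow> 'a \<Rightarrow> int" where
  "root_height \<alpha> v = (\<Sum>i\<in>UNIV. root_coord \<alpha> v i)"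

definition weight_polytope :: "'a::euclidean_space set \<Rightarrow> 'a \<Rightarrow> 'a set" where
  "weight_polytope \<Phi> \<theta> = convex hull {\<theta> - w \<theta> | w. w \<in> weyl_group \<Phi>}"

section \<open>The field of rational functions\<close>

text \<open>
  The linear order on \<open>'r\<close> is only there because the library derives the absence of zero divisors
  in the polynomial ring from it.
\<close>

type_synonym 'r ratfun = "(('r \<Rightarrow>\<^sub>0 nat) \<Rightarrow>\<^sub>0 complex) fract"

definition rf_const :: "complex \<Rightarrow> 'r::linorder ratfun" where
  "rf_const c = Fraction_Field.Fract (Poly_Mapping.single 0 c) 1"

definition rf_var :: "'r::linorder \<Rightarrow> 'r ratfun" where
  "rf_var i = Fraction_Field.Fract (Poly_Mapping.single (Poly_Mapping.single i 1) 1) 1"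

definition poly_eval ::
    "('r::{finite,linorder} \<Rightarrow> 'r ratfun) \<Rightarrow> (('r \<Rightarrow>\<^sub>0 nat) \<Rightarrow>\<^sub>0 complex) \<Rightarrow> 'r ratfun" where
  "poly_eval v p =
     (\<Sum>m\<in>Poly_Mapping.keys p.
        rf_const (Poly_Mapping.lookup p m) * (\<Prod>i\<in>UNIV. v i ^ Poly_Mapping.lookup m i))"

text \<open>
  \<open>rf_eval v f\<close> is \<open>f(v\<^sub>1, \<dots>, v\<^sub>r)\<close>. It does not depend on the chosen fraction as
  long as no nonzero polynomial vanishes at \<open>v\<close>; below, \<open>v\<close> is always the image of the tuple of
  variables under an automorphism of the field.
\<close>

definition rf_eval :: "('r::{finite,linorder} \<Rightarrow> 'r ratfun) \<Rightarrow> 'r ratfun \<Rightarrow> 'r ratfun" where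
  "rf_eval v f =
     (let (a, b) = (SOME (a, b). b \<noteq> 0 \<and> f = Fraction_Field.Fract a b)
      in poly_eval v a / poly_eval v b)"

section \<open>The actions of the Weyl group\<close>

definition rf_q :: "nat \<Rightarrow> 'r::linorder ratfun" where
  "rf_q q = rf_const (of_nat q)"

definition rf_sqrt_q :: "nat \<Rightarrow> 'r::linorder ratfun" where
  "rf_sqrt_q q = rf_const (complex_of_real (sqrt (real q)))"

text \<open>Points are tuples of elements of the field; the generic point is \<^const>\<open>rf_var\<close>.\<close>

definition sigma_pt ::
    "nat \<Rightarrow> ('r::linorder \<Rightarrow> 'a::euclidean_space) \<Rightarrow> 'r \<Rightarrow> ('r \<Rightarrow> 'r ratfun) \<Rightarrow> 'r \<Rightarrow> 'r ratfun" where
  "sigma_pt q \<alpha> i v j =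
     (if adjacent \<alpha> i j then v i * v j * rf_sqrt_q q
      else if j = i then 1 / (rf_q q * v j)
      else v j)"

definition epsilon_pt ::
    "('r::linorder \<Rightarrow> 'a::euclidean_space) \<Rightarrow> 'r \<Rightarrow> ('r \<Rightarrow> 'r ratfun) \<Rightarrow> 'r \<Rightarrow> 'r ratfun" where
  "epsilon_pt \<alpha> i v j = (if adjacent \<alpha> i j then - v j else v j)"

definition rf_plus ::
    "('r::{finite,linorder} \<Rightarrow> 'a::euclidean_space) \<Rightarrow> ('r \<Rightarrow> nat) \<Rightarrow> 'r \<Rightarrow> 'r ratfun \<Rightarrow> 'r ratfun" where
  "rf_plus \<alpha> l i f = (f + (-1) ^ l i * rf_eval (epsilon_pt \<alpha> i rf_var) f) / 2"

definition rf_minus ::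
    "('r::{finite,linorder} \<Rightarrow> 'a::euclidean_space) \<Rightarrow> ('r \<Rightarrow> nat) \<Rightarrow> 'r \<Rightarrow> 'r ratfun \<Rightarrow> 'r ratfun" where
  "rf_minus \<alpha> l i f = (f - (-1) ^ l i * rf_eval (epsilon_pt \<alpha> i rf_var) f) / 2"

definition slash_simple ::
    "nat \<Rightarrow> ('r::{finite,linorder} \<Rightarrow> 'a::euclidean_space) \<Rightarrow> ('r \<Rightarrow> nat) \<Rightarrow>
     'r ratfun \<Rightarrow> 'r \<Rightarrow> 'r ratfun" where
  "slash_simple q \<alpha> l f i =
     - ((1 - rf_q q * rf_var i) / (rf_q q * rf_var i * (1 - rf_var i)))
         * (rf_var i * rf_sqrt_q q) ^ l i
         * rf_eval (sigma_pt q \<alpha> i rf_var) (rf_plus \<alpha> l i f)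
     + 1 / (rf_var i * rf_sqrt_q q)
         * (rf_var i * rf_sqrt_q q) ^ l i
         * rf_eval (sigma_pt q \<alpha> i rf_var) (rf_minus \<alpha> l i f)"

text \<open>
  The two actions are given on simple reflections and extended along an expression of \<open>w\<close> as a
  product of simple reflections; since both do extend to \<open>W\<close>, the choice of the expression is
  immaterial. For \<open>w = \<sigma>\<^sub>a \<sigma>\<^sub>b \<cdots>\<close> the left action is \<open>wx = \<sigma>\<^sub>a (\<sigma>\<^sub>b (\<cdots> x))\<close> and
  the right one is \<open>f|w = ((f|\<sigma>\<^sub>a)|\<sigma>\<^sub>b)| \<cdots>\<close>.
\<close>

definition weyl_word :: "('r \<Rightarrow> 'a::euclidean_space) \<Rightarrow> ('a \<Rightarrow> 'a) \<Rightarrow> 'r list" where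
  "weyl_word \<alpha> w = (SOME is. w = foldr (\<lambda>i g. reflection (\<alpha> i) \<circ> g) is id)"

definition weyl_pt ::
    "nat \<Rightarrow> ('r::linorder \<Rightarrow> 'a::euclidean_space) \<Rightarrow> ('a \<Rightarrow> 'a) \<Rightarrow> ('r \<Rightarrow> 'r ratfun) \<Rightarrow> 'r \<Rightarrow> 'r ratfun" where
  "weyl_pt q \<alpha> w v = foldr (sigma_pt q \<alpha>) (weyl_word \<alpha> w) v"

definition slash ::
    "nat \<Rightarrow> ('r::{finite,linorder} \<Rightarrow> 'a::euclidean_space) \<Rightarrow> ('r \<Rightarrow> nat) \<Rightarrow>
     'r ratfun \<Rightarrow> ('a \<Rightarrow> 'a) \<Rightarrow> 'r ratfun" where
  "slash q \<alpha> l f w = foldl (slash_simple q \<alpha> l) f (weyl_word \<alpha> w)"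

section \<open>The rational function f and its numerator N\<close>

definition monom_pt ::
    "('r::{finite,linorder} \<Rightarrow> 'a::euclidean_space) \<Rightarrow> ('r \<Rightarrow> 'r ratfun) \<Rightarrow> 'a \<Rightarrow> 'r ratfun" where
  "monom_pt \<alpha> v \<mu> = (\<Prod>i\<in>UNIV. v i powi root_coord \<alpha> \<mu> i)"

definition Delta_pt ::
    "nat \<Rightarrow> 'a::euclidean_space set \<Rightarrow> ('r::{finite,linorder} \<Rightarrow> 'a) \<Rightarrow> ('r \<Rightarrow> 'r ratfun) \<Rightarrow> 'r ratfun" where
  "Delta_pt q \<Phi> \<alpha> v =
     (\<Prod>\<beta>\<in>pos_roots \<Phi> \<alpha>. 1 - rf_q q powi root_height \<alpha> \<beta> * monom_pt \<alpha> v (2 *\<^sub>R \<beta>))"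

definition D_fun ::
    "nat \<Rightarrow> 'a::euclidean_space set \<Rightarrow> ('r::{finite,linorder} \<Rightarrow> 'a) \<Rightarrow> 'r ratfun" where
  "D_fun q \<Phi> \<alpha> =
     (\<Prod>\<beta>\<in>pos_roots \<Phi> \<alpha>.
        1 - rf_q q powi (root_height \<alpha> \<beta> - 1) * monom_pt \<alpha> rf_var (2 *\<^sub>R \<beta>))"

definition j_fun ::
    "nat \<Rightarrow> 'a::euclidean_space set \<Rightarrow> ('r::{finite,linorder} \<Rightarrow> 'a) \<Rightarrow> ('a \<Rightarrow> 'a) \<Rightarrow> 'r ratfun" where
  "j_fun q \<Phi> \<alpha> w = Delta_pt q \<Phi> \<alpha> rf_var / Delta_pt q \<Phi> \<alpha> (weyl_pt q \<alpha> w rf_var)"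

definition f_fun ::
    "nat \<Rightarrow> 'a::euclidean_space set \<Rightarrow> ('r::{finite,linorder} \<Rightarrow> 'a) \<Rightarrow> ('r \<Rightarrow> nat) \<Rightarrow> 'r ratfun" where
  "f_fun q \<Phi> \<alpha> l =
     inverse (Delta_pt q \<Phi> \<alpha> rf_var) *
       (\<Sum>w\<in>weyl_group \<Phi>. j_fun q \<Phi> \<alpha> w * slash q \<alpha> l 1 w)"

definition N_fun ::
    "nat \<Rightarrow> 'a::euclidean_space set \<Rightarrow> ('r::{finite,linorder} \<Rightarrow> 'a) \<Rightarrow> ('r \<Rightarrow> nat) \<Rightarrow> 'r ratfun" where
  "N_fun q \<Phi> \<alpha> l = D_fun q \<Phi> \<alpha> * f_fun q \<Phi> \<alpha> l"

end

theory Submission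
  imports Defs
begin

text \<open>
  A nonzero Laurent polynomial \<open>\<Sum>\<^sub>\<mu> a\<^sub>\<mu> x\<^sup>\<mu>\<close> has its support in a compact convex set exactly when,
  for every linear form \<open>z \<bullet> _\<close>, the minimum of \<open>z \<bullet> \<mu>\<close> over the support is at least the minimum of
  the form over the set. The first minimum is the value at the polynomial of a valuation \<open>v\<^sub>z\<close>
  (\<open>rf_val\<close>) of the whole field of rational functions: the order of vanishing at
  \<open>t = 0\<close> after each \<open>x\<^sub>i\<close> is multiplied by \<open>t\<close> to the power \<open>z \<bullet> \<alpha>\<^sub>i\<close>.
  So it suffices to bound \<open>v\<^sub>z\<close> from below on \<open>N\<close>, and since
  \<open>N = D \<Sum>\<^sub>w (1|w) / \<Delta>(wx)\<close>, it suffices to do this for each summand.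

  The substitution \<open>x \<mapsto> \<sigma>\<^sub>i x\<close> sends \<open>x\<^sup>\<mu>\<close> to a constant times \<open>x\<close> to the power \<open>\<sigma>\<^sub>i \<mu>\<close>, hence turns \<open>v\<^sub>z\<close>
  into \<open>v\<close> at \<open>\<sigma>\<^sub>i z\<close>, while \<open>x \<mapsto> \<epsilon>\<^sub>i x\<close> only changes signs of coefficients. In the rational
  factor of the slash operator \<open>1 - q x\<^sub>i\<close> and \<open>1 - x\<^sub>i\<close> have the same valuation, so one
  application of \<open>|\<sigma>\<^sub>i\<close> shifts the bound by \<open>(l\<^sub>i - 1) (z \<bullet> \<alpha>\<^sub>i)\<close> (\<open>slash_simple_val_ge\<close>). Put
  \<open>\<tau> = \<theta> - 2\<rho>\<close>. As \<open>\<tau> \<bullet> \<alpha>\<^sub>i = l\<^sub>i - 1\<close>, that shift is \<open>z \<bullet> (\<tau> - \<sigma>\<^sub>i \<tau>)\<close>, and these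
  shifts telescope along a word to \<open>v\<^sub>z(1|w) \<ge> z \<bullet> (\<tau> - w\<inverse>\<tau>)\<close> (\<open>slash_word_val_ge\<close>).

  The binomial factors of \<open>D\<close> and of \<open>\<Delta>(wx)\<close> contribute
  \<open>min 0 (2 (z \<bullet> \<beta>))\<close> and \<open>min 0 (2 (z \<bullet> w\<inverse>\<beta>))\<close>. Writing \<open>min 0 (2t) = t - \<bar>t\<bar>\<close> and using that
  \<open>W\<close> permutes the roots up to sign, the absolute values cancel and
  \<open>v\<^sub>z(D / \<Delta>(wx)) = 2 (z \<bullet> (\<rho> - w\<inverse>\<rho>))\<close> (\<open>sum_min_weyl\<close>). Adding both,
  each summand has valuation at least \<open>z \<bullet> (\<theta> - w\<inverse>\<theta>)\<close> (\<open>N_summand_val_ge\<close>), which is a value of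
  the form at one of the points spanning the polytope.
\<close>

section \<open>Monomial valuations on polynomials\<close>

definition exp_weight :: "('r::finite \<Rightarrow> real) \<Rightarrow> ('r \<Rightarrow>\<^sub>0 nat) \<Rightarrow> real" where
  "exp_weight u k = (\<Sum>i\<in>UNIV. real (Poly_Mapping.lookup k i) * u i)"

lemma exp_weight_0 [simp]: "exp_weight u 0 = 0"
  by (simp add: exp_weight_def)

lemma exp_weight_add: "exp_weight u (k + m) = exp_weight u k + exp_weight u m"
  by (simp add: exp_weight_def lookup_add algebra_simps sum.distrib)

lemma exp_weight_single [simp]: "exp_weight u (Poly_Mapping.single i 1) = u i"
proof -
  have "exp_weight u (Poly_Mapping.single i 1) = (\<Sum>j\<in>UNIV. if j = i then u i else 0)"
    unfolding exp_weight_def by (intro sum.cong) (auto simp: lookup_single when_def)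
  then show ?thesis by simp
qed

definition poly_val ::
    "('r::finite \<Rightarrow> real) \<Rightarrow> (('r \<Rightarrow>\<^sub>0 nat) \<Rightarrow>\<^sub>0 complex) \<Rightarrow> real" where
  "poly_val u p = Min (exp_weight u ` Poly_Mapping.keys p)"

lemma keys_nonempty: "p \<noteq> 0 \<Longrightarrow> Poly_Mapping.keys p \<noteq> {}"
  by (metis poly_mapping_eqI empty_iff in_keys_iff lookup_zero)

lemma poly_val_le: "k \<in> Poly_Mapping.keys p \<Longrightarrow> poly_val u p \<le> exp_weight u k"
  by (simp add: poly_val_def)

lemma poly_val_attained:
  assumes "p \<noteq> 0"
  obtains k where "k \<in> Poly_Mapping.keys p" "exp_weight u k = poly_val u p"
proof -
  have "poly_val u p \<in> exp_weight u ` Poly_Mapping.keys p"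
    unfolding poly_val_def using keys_nonempty[OF assms] by (intro Min_in) auto
  then show thesis using that by force
qed

lemma poly_val_greatest:
  assumes "p \<noteq> 0" "\<And>k. k \<in> Poly_Mapping.keys p \<Longrightarrow> c \<le> exp_weight u k"
  shows "c \<le> poly_val u p"
  using assms by (metis poly_val_attained)

lemma single_eq_0_iff [simp]: "Poly_Mapping.single k c = 0 \<longleftrightarrow> c = 0"
  by (metis lookup_single_eq lookup_zero single_zero)

lemma poly_val_single: "c \<noteq> 0 \<Longrightarrow> poly_val u (Poly_Mapping.single k c) = exp_weight u k"
  by (simp add: poly_val_def)

lemma poly_val_1 [simp]: "poly_val u 1 = 0"
  by (simp add: poly_val_def)

lemma poly_val_add:
  assumes "p + q \<noteq> 0" "c \<le> poly_val u p" "c \<le> poly_val u q"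
  shows "c \<le> poly_val u (p + q)"
proof (rule poly_val_greatest[OF assms(1)])
  fix k assume "k \<in> Poly_Mapping.keys (p + q)"
  then have "k \<in> Poly_Mapping.keys p \<or> k \<in> Poly_Mapping.keys q"
    using keys_add[of p q] by auto
  then show "c \<le> exp_weight u k"
    using poly_val_le[of k p u] poly_val_le[of k q u] assms(2,3) by linarith
qed

lemma initial_form_split:
  fixes p :: "('r::{finite,linorder} \<Rightarrow>\<^sub>0 nat) \<Rightarrow>\<^sub>0 complex"
  assumes "p \<noteq> 0"
  obtains p0 p1 where "p = p0 + p1" "p0 \<noteq> 0"
    "\<And>k. k \<in> Poly_Mapping.keys p0 \<Longrightarrow> exp_weight u k = poly_val u p"
    "\<And>k. k \<in> Poly_Mapping.keys p1 \<Longrightarrow> exp_weight u k > poly_val u p"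
proof -
  define part where "part A = (\<Sum>k\<in>A. Poly_Mapping.single k (Poly_Mapping.lookup p k))" for A
  define A where "A = {k \<in> Poly_Mapping.keys p. exp_weight u k = poly_val u p}"
  have lookup_part: "Poly_Mapping.lookup (part B) k = (if k \<in> B then Poly_Mapping.lookup p k else 0)"
    if "finite B" for B k
    using that by (simp add: part_def lookup_sum lookup_single when_def)
  have fin: "finite A" "finite (Poly_Mapping.keys p - A)"
    by (simp_all add: A_def)
  show thesis
  proof
    show "p = part A + part (Poly_Mapping.keys p - A)"
      by (rule poly_mapping_eqI) (auto simp: lookup_add lookup_part fin A_def in_keys_iff)
    obtain k where "k \<in> Poly_Mapping.keys p" "exp_weight u k = poly_val u p"
      using poly_val_attained[OF assms] .
    then have "Poly_Mapping.lookup (part A) k \<noteq> 0"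
      by (simp add: lookup_part fin) (auto simp: A_def in_keys_iff)
    then show "part A \<noteq> 0" by auto
  next
    fix k assume "k \<in> Poly_Mapping.keys (part A)"
    then show "exp_weight u k = poly_val u p"
      by (auto simp: in_keys_iff lookup_part fin A_def split: if_splits)
  next
    fix k assume "k \<in> Poly_Mapping.keys (part (Poly_Mapping.keys p - A))"
    then have "k \<in> Poly_Mapping.keys p" "k \<notin> A"
      by (auto simp: in_keys_iff lookup_part fin split: if_splits)
    then show "exp_weight u k > poly_val u p"
      using poly_val_le[of k p u] by (auto simp: A_def)
  qed
qed

text \<open>
  The product of the two initial forms is nonzero because the polynomial ring has no zero divisors,
  and no other product of homogeneous parts reaches the same weight, so nothing cancels it. The
  weights may tie, which is why whole initial forms are multiplied and not single monomials.
\<close>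
lemma poly_val_mult:
  fixes p q :: "('r::{finite,linorder} \<Rightarrow>\<^sub>0 nat) \<Rightarrow>\<^sub>0 complex"
  assumes "p \<noteq> 0" "q \<noteq> 0"
  shows "poly_val u (p * q) = poly_val u p + poly_val u q"
proof (rule antisym)
  have "p * q \<noteq> 0" using assms by simp
  then show "poly_val u p + poly_val u q \<le> poly_val u (p * q)"
  proof (rule poly_val_greatest)
    fix k assume "k \<in> Poly_Mapping.keys (p * q)"
    then obtain a b where "k = a + b" "a \<in> Poly_Mapping.keys p" "b \<in> Poly_Mapping.keys q"
      using keys_mult by blast
    then show "poly_val u p + poly_val u q \<le> exp_weight u k"
      using poly_val_le[of a p u] poly_val_le[of b q u] by (simp add: exp_weight_add)
  qed
next
  obtain p0 p1 where p: "p = p0 + p1" "p0 \<noteq> 0"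
    "\<And>k. k \<in> Poly_Mapping.keys p0 \<Longrightarrow> exp_weight u k = poly_val u p"
    "\<And>k. k \<in> Poly_Mapping.keys p1 \<Longrightarrow> exp_weight u k > poly_val u p"
    using initial_form_split[OF assms(1)] by metis
  obtain q0 q1 where q: "q = q0 + q1" "q0 \<noteq> 0"
    "\<And>k. k \<in> Poly_Mapping.keys q0 \<Longrightarrow> exp_weight u k = poly_val u q"
    "\<And>k. k \<in> Poly_Mapping.keys q1 \<Longrightarrow> exp_weight u k > poly_val u q"
    using initial_form_split[OF assms(2)] by metis
  have "p0 * q0 \<noteq> 0" using p(2) q(2) by simp
  then obtain k where k: "k \<in> Poly_Mapping.keys (p0 * q0)"
    using keys_nonempty by blast
  then obtain a b where "k = a + b" "a \<in> Poly_Mapping.keys p0" "b \<in> Poly_Mapping.keys q0"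
    using keys_mult by blast
  then have wk: "exp_weight u k = poly_val u p + poly_val u q"
    using p(3) q(3) by (simp add: exp_weight_add)
  have above: "k \<notin> Poly_Mapping.keys (p' * q')"
    if "\<And>a b. a \<in> Poly_Mapping.keys p' \<Longrightarrow> b \<in> Poly_Mapping.keys q' \<Longrightarrow>
          poly_val u p + poly_val u q < exp_weight u a + exp_weight u b" for p' q'
    using that keys_mult[of p' q'] wk by (fastforce simp: exp_weight_add)
  have "k \<notin> Poly_Mapping.keys (p0 * q1)" "k \<notin> Poly_Mapping.keys (p1 * q0)"
       "k \<notin> Poly_Mapping.keys (p1 * q1)"
    by (rule above; use p(3,4) q(3,4) in \<open>fastforce intro: add_strict_mono\<close>)+
  moreover have "p * q = p0 * q0 + p0 * q1 + p1 * q0 + p1 * q1"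
    by (simp add: p(1) q(1) algebra_simps)
  ultimately have "k \<in> Poly_Mapping.keys (p * q)"
    using k by (simp add: in_keys_iff lookup_add)
  then show "poly_val u (p * q) \<le> poly_val u p + poly_val u q"
    using poly_val_le[of k "p * q" u] wk by simp
qed

section \<open>Extension to rational functions\<close>

text \<open>
  The valuation of a fraction is the difference of the valuations of numerator and denominator,
  which \<open>poly_val_mult\<close> makes independent of the chosen fraction. The value at \<open>0\<close> is unspecified;
  \<open>val_ge\<close> below treats it as \<open>\<infinity>\<close>.
\<close>
definition rf_val :: "('r::{finite,linorder} \<Rightarrow> real) \<Rightarrow> 'r ratfun \<Rightarrow> real" where
  "rf_val u f = (THE r. \<exists>a b. a \<noteq> 0 \<and> b \<noteq> 0 \<and> f = Fraction_Field.Fract a b \<and>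
                         r = poly_val u a - poly_val u b)"

lemma rf_val_Fract:
  fixes a b :: "('r::{finite,linorder} \<Rightarrow>\<^sub>0 nat) \<Rightarrow>\<^sub>0 complex"
  assumes "a \<noteq> 0" "b \<noteq> 0"
  shows "rf_val u (Fraction_Field.Fract a b) = poly_val u a - poly_val u b"
  unfolding rf_val_def
proof (rule the_equality)
  fix r assume "\<exists>c d. c \<noteq> 0 \<and> d \<noteq> 0 \<and> Fraction_Field.Fract a b = Fraction_Field.Fract c d \<and>
                     r = poly_val u c - poly_val u d"
  then obtain c d where cd: "c \<noteq> 0" "d \<noteq> 0"
    "Fraction_Field.Fract a b = Fraction_Field.Fract c d" "r = poly_val u c - poly_val u d"
    by blast
  then have "a * d = c * b" using assms by (simp add: eq_fract)
  then have "poly_val u a + poly_val u d = poly_val u c + poly_val u b"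
    using poly_val_mult[of a d u] poly_val_mult[of c b u] assms cd by simp
  then show "r = poly_val u a - poly_val u b" using cd(4) by simp
qed (use assms in blast)

lemma Fract_eq_0_iff: "b \<noteq> 0 \<Longrightarrow> Fraction_Field.Fract a b = 0 \<longleftrightarrow> a = (0::'z::idom)"
  by (simp add: Zero_fract_def eq_fract)

lemma rf_val_mult:
  assumes "f \<noteq> 0" "g \<noteq> 0"
  shows "rf_val u (f * g) = rf_val u f + rf_val u g"
proof -
  obtain a b c d where f: "f = Fraction_Field.Fract a b" "a \<noteq> 0" "b \<noteq> 0"
    and g: "g = Fraction_Field.Fract c d" "c \<noteq> 0" "d \<noteq> 0"
    using assms by (metis Fract_cases_nonzero)
  show ?thesis
    unfolding f(1) g(1) using f(2,3) g(2,3) by (simp add: rf_val_Fract poly_val_mult)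
qed

lemma rf_val_const [simp]: "c \<noteq> 0 \<Longrightarrow> rf_val u (rf_const c) = 0"
  unfolding rf_const_def by (subst rf_val_Fract) (auto simp: poly_val_single simp del: single_one)

lemma rf_val_var [simp]: "rf_val u (rf_var i) = u i"
  unfolding rf_var_def
  by (simp add: rf_val_Fract poly_val_single One_nat_def[symmetric] del: One_nat_def)

lemma rf_const_0 [simp]: "rf_const 0 = 0"
  by (simp add: rf_const_def fract_collapse)

lemma rf_const_1 [simp]: "rf_const 1 = 1"
  by (simp add: rf_const_def fract_collapse)

lemma rf_const_add: "rf_const (a + b) = rf_const a + rf_const b"
  by (simp add: rf_const_def single_add)

lemma rf_const_mult: "rf_const (a * b) = rf_const a * rf_const b"
  by (simp add: rf_const_def mult_single)

lemma rf_const_uminus: "rf_const (- a) = - rf_const a"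
  by (simp add: rf_const_def single_uminus)

lemma rf_const_eq_0_iff [simp]: "rf_const c = 0 \<longleftrightarrow> c = 0"
  by (simp add: rf_const_def Fract_eq_0_iff)

lemma rf_const_prod: "rf_const (\<Prod>i\<in>A. c i) = (\<Prod>i\<in>A. rf_const (c i))"
  by (induction A rule: infinite_finite_induct) (auto simp: rf_const_mult)

lemma rf_const_inverse: "rf_const (inverse c) = inverse (rf_const c)"
proof (cases "c = 0")
  case False
  then have "rf_const (inverse c) * rf_const c = 1"
    by (simp flip: rf_const_mult)
  then show ?thesis by (simp add: field_simps False)
qed simp

lemma rf_const_power: "rf_const (c ^ n) = rf_const c ^ n"
  by (induction n) (auto simp: rf_const_mult)

lemma rf_const_powi: "rf_const (c powi n) = rf_const c powi n"
  by (simp add: power_int_def rf_const_power rf_const_inverse)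

lemma rf_var_nonzero [simp]: "rf_var i \<noteq> 0"
  by (simp add: rf_var_def Fract_eq_0_iff)

lemma rf_val_1 [simp]: "rf_val u 1 = 0"
  using rf_val_const[of 1 u] by simp

lemma rf_val_inverse: "f \<noteq> 0 \<Longrightarrow> rf_val u (inverse f) = - rf_val u f"
  using rf_val_mult[of f "inverse f" u] by simp

lemma rf_val_prod:
  assumes "\<And>i. i \<in> A \<Longrightarrow> f i \<noteq> 0"
  shows "rf_val u (\<Prod>i\<in>A. f i) = (\<Sum>i\<in>A. rf_val u (f i))"
  using assms
  by (induction A rule: infinite_finite_induct) (auto simp: rf_val_mult)

lemma rf_val_power: "f \<noteq> 0 \<Longrightarrow> rf_val u (f ^ n) = real n * rf_val u f"
  by (induction n) (auto simp: rf_val_mult algebra_simps)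

lemma rf_val_powi: "f \<noteq> 0 \<Longrightarrow> rf_val u (f powi n) = of_int n * rf_val u f"
  by (auto simp: power_int_def rf_val_power rf_val_inverse)

definition val_ge :: "('r::{finite,linorder} \<Rightarrow> real) \<Rightarrow> real \<Rightarrow> 'r ratfun \<Rightarrow> bool" where
  "val_ge u c f \<longleftrightarrow> f = 0 \<or> c \<le> rf_val u f"

lemma val_ge_0 [simp]: "val_ge u c 0"
  by (simp add: val_ge_def)

lemma val_ge_1: "val_ge u 0 1"
  by (simp add: val_ge_def)

lemma val_ge_mono: "val_ge u c f \<Longrightarrow> d \<le> c \<Longrightarrow> val_ge u d f"
  by (auto simp: val_ge_def)

lemma val_ge_mult: "val_ge u c f \<Longrightarrow> val_ge u d g \<Longrightarrow> val_ge u (c + d) (f * g)"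
  by (cases "f = 0 \<or> g = 0") (auto simp: val_ge_def rf_val_mult)

lemma val_ge_add:
  assumes "val_ge u c f" "val_ge u c g"
  shows "val_ge u c (f + g)"
proof (cases "f = 0 \<or> g = 0 \<or> f + g = 0")
  case True
  then show ?thesis using assms by auto
next
  case False
  obtain a b d e where f: "f = Fraction_Field.Fract a b" "a \<noteq> 0" "b \<noteq> 0"
    and g: "g = Fraction_Field.Fract d e" "d \<noteq> 0" "e \<noteq> 0"
    using False by (metis Fract_cases_nonzero)
  have sum: "f + g = Fraction_Field.Fract (a * e + d * b) (b * e)"
    using f g by simp
  have nz: "a * e + d * b \<noteq> 0"
    using False sum f g by (auto simp: Fract_eq_0_iff)
  have "c + poly_val u b \<le> poly_val u a" "c + poly_val u e \<le> poly_val u d"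
    using assms f g False by (auto simp: val_ge_def rf_val_Fract)
  then have "c + poly_val u b + poly_val u e \<le> poly_val u (a * e + d * b)"
    using nz f g by (intro poly_val_add) (auto simp: poly_val_mult)
  then show ?thesis
    unfolding val_ge_def sum using f g nz by (simp add: rf_val_Fract poly_val_mult)
qed

lemma val_ge_sum:
  assumes "\<And>i. i \<in> A \<Longrightarrow> val_ge u c (f i)"
  shows "val_ge u c (\<Sum>i\<in>A. f i)"
  using assms by (induction A rule: infinite_finite_induct) (auto intro: val_ge_add)

lemma val_ge_const: "val_ge u 0 (rf_const c)"
  by (cases "c = 0") (simp_all add: val_ge_def)

lemma val_ge_const_mult: "val_ge u c f \<Longrightarrow> val_ge u c (rf_const d * f)"
  using val_ge_mult[OF val_ge_const, of u c f d] by simp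

section \<open>Simply laced root systems in simple-root coordinates\<close>

lemma linear_reflection: "linear (reflection \<beta>)"
  by (rule linearI) (simp_all add: reflection_def inner_add_left add_divide_distrib algebra_simps)

locale simply_laced_system =
  fixes \<Phi> :: "'a::euclidean_space set"
    and \<alpha> :: "'r::{finite,linorder} \<Rightarrow> 'a"
    and q :: nat
    and l :: "'r \<Rightarrow> nat"
  assumes root_system: "root_system \<Phi>" and reduced: "reduced_roots \<Phi>"
    and simply_laced: "simply_laced \<Phi>" and normalized: "normalized_roots \<Phi>"
    and simple_roots: "simple_roots \<Phi> \<alpha>"
    and q_pos: "0 < q"
begin

abbreviation simple_refl :: "'r \<Rightarrow> 'a \<Rightarrow> 'a" where
  "simple_refl i \<equiv> reflection (\<alpha> i)"

lemma finite_roots: "finite \<Phi>" and zero_not_root: "0 \<notin> \<Phi>" and span_roots: "span \<Phi> = UNIV"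
  and reflection_root: "\<beta> \<in> \<Phi> \<Longrightarrow> \<gamma> \<in> \<Phi> \<Longrightarrow> reflection \<beta> \<gamma> \<in> \<Phi>"
  using root_system by (auto simp: root_system_def)

lemma root_norm: "\<beta> \<in> \<Phi> \<Longrightarrow> \<beta> \<bullet> \<beta> = 2"
  using normalized by (auto simp: normalized_roots_def)

lemma root_inner_Ints: "\<beta> \<in> \<Phi> \<Longrightarrow> \<gamma> \<in> \<Phi> \<Longrightarrow> \<beta> \<bullet> \<gamma> \<in> \<int>"
  using root_system root_norm[of \<gamma>] unfolding root_system_def
  by (metis nonzero_mult_div_cancel_left zero_neq_numeral)

lemma reflection_eq: "\<beta> \<in> \<Phi> \<Longrightarrow> reflection \<beta> v = v - (v \<bullet> \<beta>) *\<^sub>R \<beta>"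
  by (simp add: reflection_def root_norm)

lemma reflection_invol: "\<beta> \<in> \<Phi> \<Longrightarrow> reflection \<beta> (reflection \<beta> v) = v"
  by (simp add: reflection_eq root_norm inner_diff_left algebra_simps)

lemma reflection_adjoint: "\<beta> \<in> \<Phi> \<Longrightarrow> reflection \<beta> z \<bullet> v = z \<bullet> reflection \<beta> v"
  by (simp add: reflection_eq inner_diff_left inner_diff_right inner_commute)

lemma neg_root: "\<beta> \<in> \<Phi> \<Longrightarrow> - \<beta> \<in> \<Phi>"
  using reflection_root[of \<beta> \<beta>] by (simp add: reflection_eq root_norm scaleR_2)

lemma simple_root: "\<alpha> i \<in> \<Phi>"
  using simple_roots by (auto simp: simple_roots_def)

lemma coords_unique:
  assumes "(\<Sum>i\<in>UNIV. k i *\<^sub>R \<alpha> i) = (\<Sum>i\<in>UNIV. m i *\<^sub>R \<alpha> i)"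
  shows "k i = m i"
proof -
  have inj: "inj \<alpha>" and ind: "independent (range \<alpha>)"
    using simple_roots by (auto simp: simple_roots_def)
  have "(\<Sum>v\<in>range \<alpha>. (k (inv \<alpha> v) - m (inv \<alpha> v)) *\<^sub>R v) = (\<Sum>i\<in>UNIV. (k i - m i) *\<^sub>R \<alpha> i)"
    using inj by (subst sum.reindex) (auto simp: inv_f_f)
  also have "\<dots> = 0" using assms by (simp add: scaleR_diff_left sum_subtractf)
  finally have "k (inv \<alpha> v) - m (inv \<alpha> v) = 0" if "v \<in> range \<alpha>" for v
    using ind[unfolded independent_explicit, THEN conjunct2, rule_format,
        of "\<lambda>v. k (inv \<alpha> v) - m (inv \<alpha> v)" v] that by simp
  from this[of "\<alpha> i"] show ?thesis using inj by (simp add: inv_f_f)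
qed

lemma single_coord: "(\<Sum>j\<in>UNIV. (if j = i then c else 0) *\<^sub>R \<alpha> j) = c *\<^sub>R \<alpha> i"
  by (simp add: if_distrib[of "\<lambda>c. c *\<^sub>R _"] cong: if_cong)

lemma root_latticeI: "\<mu> = (\<Sum>i\<in>UNIV. of_int (k i) *\<^sub>R \<alpha> i) \<Longrightarrow> \<mu> \<in> root_lattice \<alpha>"
  unfolding root_lattice_def by blast

lemma root_coord_eqI:
  assumes "\<mu> = (\<Sum>i\<in>UNIV. of_int (k i) *\<^sub>R \<alpha> i)"
  shows "root_coord \<alpha> \<mu> = k"
  unfolding root_coord_def
proof (rule the_equality)
  fix m assume "\<mu> = (\<Sum>i\<in>UNIV. of_int (m i) *\<^sub>R \<alpha> i)"
  then have "real_of_int (m i) = of_int (k i)" for i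
    using assms by (intro coords_unique) simp
  then show "m = k" by auto
qed (use assms in simp)

lemma lattice_expansion:
  "\<mu> \<in> root_lattice \<alpha> \<Longrightarrow> (\<Sum>i\<in>UNIV. of_int (root_coord \<alpha> \<mu> i) *\<^sub>R \<alpha> i) = \<mu>"
  unfolding root_lattice_def using root_coord_eqI by auto

lemma lattice_0: "0 \<in> root_lattice \<alpha>"
  by (auto simp: root_lattice_def intro!: exI[of _ "\<lambda>_. 0"])

lemma lattice_lincomb:
  assumes "finite I" "\<And>j. j \<in> I \<Longrightarrow> m j \<in> root_lattice \<alpha>"
  shows "(\<Sum>j\<in>I. of_int (k j) *\<^sub>R m j) \<in> root_lattice \<alpha>" (is ?mem)
    and "root_coord \<alpha> (\<Sum>j\<in>I. of_int (k j) *\<^sub>R m j) i = (\<Sum>j\<in>I. k j * root_coord \<alpha> (m j) i)"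
proof -
  have "(\<Sum>j\<in>I. of_int (k j) *\<^sub>R m j)
      = (\<Sum>j\<in>I. of_int (k j) *\<^sub>R (\<Sum>i\<in>UNIV. of_int (root_coord \<alpha> (m j) i) *\<^sub>R \<alpha> i))"
    using assms(2) by (intro sum.cong) (auto simp: lattice_expansion)
  also have "\<dots> = (\<Sum>j\<in>I. \<Sum>i\<in>UNIV. of_int (k j * root_coord \<alpha> (m j) i) *\<^sub>R \<alpha> i)"
    by (simp add: scaleR_sum_right)
  also have "\<dots> = (\<Sum>i\<in>UNIV. of_int (\<Sum>j\<in>I. k j * root_coord \<alpha> (m j) i) *\<^sub>R \<alpha> i)"
    by (subst sum.swap) (simp add: scaleR_sum_left)
  finally have eq: "(\<Sum>j\<in>I. of_int (k j) *\<^sub>R m j)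
      = (\<Sum>i\<in>UNIV. of_int (\<Sum>j\<in>I. k j * root_coord \<alpha> (m j) i) *\<^sub>R \<alpha> i)" .
  show ?mem by (rule root_latticeI[OF eq])
  show "root_coord \<alpha> (\<Sum>j\<in>I. of_int (k j) *\<^sub>R m j) i = (\<Sum>j\<in>I. k j * root_coord \<alpha> (m j) i)"
    using root_coord_eqI[OF eq] by simp
qed

lemma simple_root_in_lattice: "\<alpha> i \<in> root_lattice \<alpha>"
  and root_coord_simple: "root_coord \<alpha> (\<alpha> i) j = (if j = i then 1 else 0)"
proof -
  have *: "\<alpha> i = (\<Sum>j\<in>UNIV. of_int (if j = i then 1 else 0) *\<^sub>R \<alpha> j)"
    using single_coord[of i 1] by (simp add: if_distrib cong: if_cong)
  show "\<alpha> i \<in> root_lattice \<alpha>"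
    by (rule root_latticeI[OF *])
  show "root_coord \<alpha> (\<alpha> i) j = (if j = i then 1 else 0)"
    using root_coord_eqI[OF *] by simp
qed

lemma lattice_add:
  assumes "\<mu> \<in> root_lattice \<alpha>" "\<nu> \<in> root_lattice \<alpha>"
  shows "\<mu> + \<nu> \<in> root_lattice \<alpha>" "root_coord \<alpha> (\<mu> + \<nu>) i = root_coord \<alpha> \<mu> i + root_coord \<alpha> \<nu> i"
  using lattice_lincomb[of "UNIV :: bool set" "\<lambda>b. if b then \<mu> else \<nu>" "\<lambda>_. 1"] assms
  by (auto simp: UNIV_bool add.commute)

lemma lattice_scale:
  assumes "\<mu> \<in> root_lattice \<alpha>"
  shows "of_int n *\<^sub>R \<mu> \<in> root_lattice \<alpha>" "root_coord \<alpha> (of_int n *\<^sub>R \<mu>) i = n * root_coord \<alpha> \<mu> i"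
  using lattice_lincomb[of "{()}" "\<lambda>_. \<mu>" "\<lambda>_. n"] assms by auto

lemma pos_root_in_lattice: "\<beta> \<in> pos_roots \<Phi> \<alpha> \<Longrightarrow> \<beta> \<in> root_lattice \<alpha>"
proof -
  assume "\<beta> \<in> pos_roots \<Phi> \<alpha>"
  then obtain k :: "'r \<Rightarrow> nat" where "\<beta> = (\<Sum>i\<in>UNIV. of_int (int (k i)) *\<^sub>R \<alpha> i)"
    by (auto simp: pos_roots_def)
  then show ?thesis by (rule root_latticeI)
qed

lemma root_in_lattice:
  assumes "\<beta> \<in> \<Phi>"
  shows "\<beta> \<in> root_lattice \<alpha>"
proof -
  have "\<beta> \<in> pos_roots \<Phi> \<alpha> \<or> - \<beta> \<in> pos_roots \<Phi> \<alpha>"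
    using simple_roots assms by (auto simp: simple_roots_def)
  then have "\<beta> \<in> root_lattice \<alpha> \<or> - \<beta> \<in> root_lattice \<alpha>"
    using pos_root_in_lattice by blast
  then show ?thesis using lattice_scale(1)[of "- \<beta>" "-1"] by auto
qed

lemma span_simple_roots: "span (range \<alpha>) = UNIV"
proof -
  have "\<beta> \<in> span (range \<alpha>)" if "\<beta> \<in> \<Phi>" for \<beta>
    by (subst lattice_expansion[OF root_in_lattice[OF that], symmetric])
       (intro span_sum span_scale span_base, simp)
  then have "span \<Phi> \<subseteq> span (range \<alpha>)" by (intro span_minimal) auto
  then show ?thesis using span_roots by auto
qed

lemma pos_root_coords:
  assumes "\<beta> \<in> pos_roots \<Phi> \<alpha>"
  shows "0 \<le> root_coord \<alpha> \<beta> i"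
proof -
  obtain k :: "'r \<Rightarrow> nat" where k: "\<beta> = (\<Sum>i\<in>UNIV. of_int (int (k i)) *\<^sub>R \<alpha> i)"
    using assms by (auto simp: pos_roots_def)
  show ?thesis using root_coord_eqI[OF k] by simp
qed

lemma pos_rootI:
  assumes "\<beta> \<in> \<Phi>" "root_coord \<alpha> \<beta> i > 0"
  shows "\<beta> \<in> pos_roots \<Phi> \<alpha>"
proof (rule ccontr)
  assume "\<beta> \<notin> pos_roots \<Phi> \<alpha>"
  then have "- \<beta> \<in> pos_roots \<Phi> \<alpha>"
    using simple_roots assms(1) by (auto simp: simple_roots_def)
  then have "0 \<le> root_coord \<alpha> (of_int (-1) *\<^sub>R \<beta>) i"
    using pos_root_coords[of "- \<beta>" i] by simp
  then show False
    using assms by (subst (asm) lattice_scale) (auto simp: root_in_lattice)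
qed

lemma pos_roots_subset: "pos_roots \<Phi> \<alpha> \<subseteq> \<Phi>" and finite_pos_roots: "finite (pos_roots \<Phi> \<alpha>)"
  using finite_roots by (auto simp: pos_roots_def)

lemma neg_pos_root:
  assumes "\<beta> \<in> pos_roots \<Phi> \<alpha>"
  shows "- \<beta> \<notin> pos_roots \<Phi> \<alpha>"
proof
  assume "- \<beta> \<in> pos_roots \<Phi> \<alpha>"
  moreover have "root_coord \<alpha> (of_int (-1) *\<^sub>R \<beta>) i = - root_coord \<alpha> \<beta> i" for i
    using assms by (subst lattice_scale) (auto simp: pos_root_in_lattice)
  ultimately have "root_coord \<alpha> \<beta> i = 0" for i
    using pos_root_coords[OF assms, of i] pos_root_coords[of "- \<beta>" i] by simp
  then have "\<beta> = 0"
    using lattice_expansion[OF pos_root_in_lattice[OF assms]] by simp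
  then show False using assms zero_not_root pos_roots_subset by auto
qed

lemma roots_eq_Un: "\<Phi> = pos_roots \<Phi> \<alpha> \<union> uminus ` pos_roots \<Phi> \<alpha>"
proof
  show "\<Phi> \<subseteq> pos_roots \<Phi> \<alpha> \<union> uminus ` pos_roots \<Phi> \<alpha>"
  proof
    fix \<beta> assume "\<beta> \<in> \<Phi>"
    then have "\<beta> \<in> pos_roots \<Phi> \<alpha> \<or> - \<beta> \<in> pos_roots \<Phi> \<alpha>"
      using simple_roots by (auto simp: simple_roots_def)
    then show "\<beta> \<in> pos_roots \<Phi> \<alpha> \<union> uminus ` pos_roots \<Phi> \<alpha>"
      using image_iff by fastforce
  qed
  show "pos_roots \<Phi> \<alpha> \<union> uminus ` pos_roots \<Phi> \<alpha> \<subseteq> \<Phi>"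
    using pos_roots_subset neg_root by auto
qed

lemma simple_reflection_coord:
  assumes "\<beta> \<in> \<Phi>" "j \<noteq> i"
  shows "root_coord \<alpha> (simple_refl i \<beta>) j = root_coord \<alpha> \<beta> j"
proof -
  obtain n where n: "\<beta> \<bullet> \<alpha> i = of_int n"
    using root_inner_Ints[OF assms(1) simple_root, of i] by (elim Ints_cases)
  have "simple_refl i \<beta> = \<beta> + of_int (- n) *\<^sub>R \<alpha> i"
    by (simp add: reflection_eq simple_root n)
  then show ?thesis
    using assms by (simp add: lattice_add lattice_scale root_in_lattice simple_root_in_lattice
        root_coord_simple del: of_int_minus)
qed

text \<open>
  A positive root other than \<open>\<alpha>\<^sub>i\<close> is not a multiple of \<open>\<alpha>\<^sub>i\<close>, so it has a positive coordinate at some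
  \<open>j \<noteq> i\<close>. The reflection keeps that coordinate, and one positive coordinate decides the sign of a
  root.
\<close>
lemma simple_reflection_permutes_pos_roots:
  assumes "\<beta> \<in> pos_roots \<Phi> \<alpha>" "\<beta> \<noteq> \<alpha> i"
  shows "simple_refl i \<beta> \<in> pos_roots \<Phi> \<alpha> - {\<alpha> i}"
proof -
  have \<beta>: "\<beta> \<in> \<Phi>" using assms pos_roots_subset by auto
  have "\<exists>j. j \<noteq> i \<and> root_coord \<alpha> \<beta> j \<noteq> 0"
  proof (rule ccontr)
    assume "\<nexists>j. j \<noteq> i \<and> root_coord \<alpha> \<beta> j \<noteq> 0"
    then have "of_int (root_coord \<alpha> \<beta> j) *\<^sub>R \<alpha> j
        = (if j = i then of_int (root_coord \<alpha> \<beta> i) else 0) *\<^sub>R \<alpha> j" for j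
      by auto
    then have *: "\<beta> = of_int (root_coord \<alpha> \<beta> i) *\<^sub>R \<alpha> i"
      using lattice_expansion[OF root_in_lattice[OF \<beta>]] single_coord
      by (metis (mono_tags, lifting) sum.cong)
    then have "real_of_int (root_coord \<alpha> \<beta> i) = 1 \<or> real_of_int (root_coord \<alpha> \<beta> i) = -1"
      using reduced \<beta> simple_root[of i] unfolding reduced_roots_def by metis
    then have "root_coord \<alpha> \<beta> i = 1"
      using pos_root_coords[OF assms(1), of i] by auto
    then show False using * assms(2) by simp
  qed
  then obtain j where j: "j \<noteq> i" "root_coord \<alpha> \<beta> j > 0"
    using pos_root_coords[OF assms(1)] by (metis order_le_less)
  then have "root_coord \<alpha> (simple_refl i \<beta>) j > 0"
    using \<beta> by (simp add: simple_reflection_coord)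
  then show ?thesis
    using pos_rootI[OF reflection_root[OF simple_root \<beta>]] j(1) by (auto simp: root_coord_simple)
qed

text \<open>
  The reflection \<open>\<sigma>\<^sub>i\<close> fixes the sum of the positive roots other than \<open>\<alpha>\<^sub>i\<close>, so that sum is
  orthogonal to \<open>\<alpha>\<^sub>i\<close>.
\<close>
lemma rho_simple: "rho \<Phi> \<alpha> \<bullet> \<alpha> i = 1"
proof -
  let ?P = "pos_roots \<Phi> \<alpha> - {\<alpha> i}"
  have \<alpha>pos: "\<alpha> i \<in> pos_roots \<Phi> \<alpha>"
    using pos_rootI[of "\<alpha> i" i] by (simp add: simple_root root_coord_simple)
  then have two_rho: "2 *\<^sub>R rho \<Phi> \<alpha> = \<alpha> i + \<Sum>?P"
    by (simp add: rho_def sum.remove[OF finite_pos_roots])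
  have "bij_betw (simple_refl i) ?P ?P"
    by (rule bij_betw_byWitness[where f' = "simple_refl i"])
       (auto simp: reflection_invol simple_root dest: simple_reflection_permutes_pos_roots)
  then have "simple_refl i (\<Sum>?P) = \<Sum>?P"
    using sum.reindex_bij_betw[of "simple_refl i" ?P ?P "\<lambda>x. x"] by (simp add: linear_sum[OF linear_reflection])
  then have "(\<Sum>?P \<bullet> \<alpha> i) *\<^sub>R \<alpha> i = 0"
    by (simp add: reflection_eq simple_root)
  then have "\<Sum>?P \<bullet> \<alpha> i = 0"
    using simple_root zero_not_root by (metis scaleR_eq_0_iff)
  then have "(2 *\<^sub>R rho \<Phi> \<alpha>) \<bullet> \<alpha> i = 2"
    unfolding two_rho by (simp add: inner_add_left root_norm simple_root)
  then show ?thesis by simp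
qed

lemma fund_weight_inner: "fund_weight \<alpha> i \<bullet> \<alpha> j = (if j = i then 1 else 0)"
proof -
  have inj: "inj \<alpha>" and ind: "independent (range \<alpha>)"
    using simple_roots by (auto simp: simple_roots_def)
  obtain g :: "'a \<Rightarrow> real" where g: "linear g"
    "\<And>x. x \<in> range \<alpha> \<Longrightarrow> g x = (if x = \<alpha> i then 1 else 0)"
    using linear_independent_extend[OF ind, of "\<lambda>x. if x = \<alpha> i then 1 else 0"] by auto
  define v where "v = adjoint g 1"
  have v: "\<forall>j. v \<bullet> \<alpha> j = (if j = i then 1 else 0)"
    using g inj by (auto simp: v_def adjoint_clauses inj_eq)
  have "fund_weight \<alpha> i = v"
    unfolding fund_weight_def
  proof (rule the_equality)
    show "\<forall>j. v \<bullet> \<alpha> j = (if j = i then 1 else 0)" by (fact v)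
  next
    fix u assume u: "\<forall>j. u \<bullet> \<alpha> j = (if j = i then 1 else 0)"
    have "orthogonal (u - v) x" if "x \<in> span (range \<alpha>)" for x
      using that by (rule orthogonal_to_span) (use u v in \<open>auto simp: orthogonal_def inner_diff_left\<close>)
    then have "orthogonal (u - v) (u - v)" by (simp add: span_simple_roots)
    then show "u = v" by (simp add: orthogonal_self)
  qed
  then show ?thesis using v by simp
qed

lemma weyl_group_linear: "w \<in> weyl_group \<Phi> \<Longrightarrow> linear w"
proof (induction rule: weyl_group.induct)
  case one
  show ?case unfolding id_def by (rule linear_ident)
next
  case (refl \<beta> w)
  then show ?case using linear_compose linear_reflection by blast
qed

lemma weyl_group_root: "w \<in> weyl_group \<Phi> \<Longrightarrow> \<beta> \<in> \<Phi> \<Longrightarrow> w \<beta> \<in> \<Phi>"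
  by (induction rule: weyl_group.induct) (auto simp: reflection_root)

lemma weyl_group_inj: "w \<in> weyl_group \<Phi> \<Longrightarrow> inj w"
proof (induction rule: weyl_group.induct)
  case (refl \<beta> w)
  have "inj (reflection \<beta>)" by (rule inj_on_inverseI) (rule reflection_invol[OF refl(1)])
  then show ?case using refl by (intro inj_compose)
qed simp

lemma weyl_group_comp_reflection:
  assumes "w \<in> weyl_group \<Phi>" "\<beta> \<in> \<Phi>"
  shows "w \<circ> reflection \<beta> \<in> weyl_group \<Phi>"
  using assms(1)
proof (induction rule: weyl_group.induct)
  case one
  show ?case using weyl_group.refl[OF assms(2) weyl_group.one] by simp
next
  case (refl \<gamma> w)
  show ?case unfolding comp_assoc by (rule weyl_group.refl) (rule refl)+
qed

lemma weyl_group_lattice: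
  assumes "w \<in> weyl_group \<Phi>" "\<mu> \<in> root_lattice \<alpha>"
  shows "w \<mu> \<in> root_lattice \<alpha>"
proof -
  have "w \<mu> = (\<Sum>i\<in>UNIV. of_int (root_coord \<alpha> \<mu> i) *\<^sub>R w (\<alpha> i))"
    by (subst lattice_expansion[OF assms(2), symmetric])
       (simp add: linear_sum linear_scale weyl_group_linear[OF assms(1)])
  also have "\<dots> \<in> root_lattice \<alpha>"
    by (intro lattice_lincomb) (auto simp: root_in_lattice weyl_group_root assms(1) simple_root)
  finally show ?thesis .
qed

text \<open>
  The roots span the space, so an element of the group is determined by its restriction to the finite
  set of roots.
\<close>
lemma finite_weyl_group: "finite (weyl_group \<Phi>)"
proof (rule inj_on_finite)
  show "inj_on (\<lambda>w. restrict w \<Phi>) (weyl_group \<Phi>)"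
  proof (rule inj_onI)
    fix v w assume vw: "v \<in> weyl_group \<Phi>" "w \<in> weyl_group \<Phi>" "restrict v \<Phi> = restrict w \<Phi>"
    then have "v \<beta> = w \<beta>" if "\<beta> \<in> \<Phi>" for \<beta>
      using that by (metis restrict_apply')
    then have "v x = w x" for x
      using linear_eq_on_span[OF vw(1,2)[THEN weyl_group_linear]] span_roots by blast
    then show "v = w" by auto
  qed
  show "(\<lambda>w. restrict w \<Phi>) ` weyl_group \<Phi> \<subseteq> \<Phi> \<rightarrow>\<^sub>E \<Phi>"
    by (auto simp: weyl_group_root)
  show "finite (\<Phi> \<rightarrow>\<^sub>E \<Phi>)"
    using finite_roots by (intro finite_PiE) auto
qed

text \<open>
  This is the combinatorial rule behind the action on points: the exponents in \<open>\<sigma>\<^sub>i x\<close> are the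
  reflected simple roots. For adjacent nodes the scalar product cannot be \<open>1\<close>, since then
  \<open>\<alpha>\<^sub>j - \<alpha>\<^sub>i\<close> would be a root with coordinates of both signs.
\<close>
lemma simple_refl_simple_root:
  "simple_refl i (\<alpha> j) = (if adjacent \<alpha> i j then \<alpha> i + \<alpha> j else if j = i then - \<alpha> j else \<alpha> j)"
proof -
  have inj: "inj \<alpha>" using simple_roots by (auto simp: simple_roots_def)
  have "\<alpha> j \<bullet> \<alpha> i = -1" if adj: "adjacent \<alpha> i j"
  proof -
    have ij: "i \<noteq> j" "\<alpha> j \<bullet> \<alpha> i \<noteq> 0" using adj by (auto simp: adjacent_def inner_commute)
    have "root_coord \<alpha> (of_int (-1) *\<^sub>R \<alpha> i) j = 0"
      using ij by (simp only: lattice_scale simple_root_in_lattice root_coord_simple) simp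
    then have "\<alpha> j \<noteq> - \<alpha> i"
      using root_coord_simple[of j j] by auto
    then have cases: "\<alpha> j \<bullet> \<alpha> i \<in> {-1, 0, 1}"
      using simply_laced simple_root root_norm ij inj unfolding simply_laced_def
      by (metis (no_types, lifting) inj_eq nonzero_mult_div_cancel_left zero_neq_numeral)
    have "\<alpha> j \<bullet> \<alpha> i \<noteq> 1"
    proof
      assume "\<alpha> j \<bullet> \<alpha> i = 1"
      then have \<gamma>: "simple_refl i (\<alpha> j) = \<alpha> j + of_int (-1) *\<^sub>R \<alpha> i"
        by (simp add: reflection_eq simple_root)
      have coord: "root_coord \<alpha> (simple_refl i (\<alpha> j)) k = (if k = j then 1 else 0) - (if k = i then 1 else 0)" for k
        unfolding \<gamma> by (simp only: lattice_add lattice_scale simple_root_in_lattice root_coord_simple)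
      have "simple_refl i (\<alpha> j) \<in> pos_roots \<Phi> \<alpha>"
        using coord[of j] ij by (intro pos_rootI[of _ j]) (auto simp: reflection_root simple_root)
      then show False using pos_root_coords[of "simple_refl i (\<alpha> j)" i] coord[of i] ij by simp
    qed
    then show ?thesis using cases ij by auto
  qed
  then show ?thesis
    by (auto simp: reflection_eq simple_root root_norm adjacent_def inner_commute scaleR_2)
qed

section \<open>Laurent polynomials and monomial substitutions\<close>

text \<open>
  With these weights of the variables, the monomial \<open>x\<^sup>\<mu>\<close> has weight \<open>z \<bullet> \<mu>\<close>
  (\<open>rf_val_xpow\<close>); the vector \<open>z\<close> represents the linear form.
\<close>
abbreviation wt :: "'a \<Rightarrow> 'r \<Rightarrow> real" where
  "wt z \<equiv> \<lambda>i. z \<bullet> \<alpha> i"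

abbreviation xpow :: "'a \<Rightarrow> 'r ratfun" where
  "xpow \<mu> \<equiv> monom_pt \<alpha> rf_var \<mu>"

lemma monom_nonzero: "(\<And>i. v i \<noteq> 0) \<Longrightarrow> monom_pt \<alpha> v \<mu> \<noteq> 0"
  by (simp add: monom_pt_def)

lemma monom_add:
  assumes "\<And>i. v i \<noteq> 0" "\<mu> \<in> root_lattice \<alpha>" "\<nu> \<in> root_lattice \<alpha>"
  shows "monom_pt \<alpha> v (\<mu> + \<nu>) = monom_pt \<alpha> v \<mu> * monom_pt \<alpha> v \<nu>"
  using assms by (simp add: monom_pt_def lattice_add power_int_add prod.distrib)

lemma monom_scale:
  assumes "\<mu> \<in> root_lattice \<alpha>"
  shows "monom_pt \<alpha> v (of_int n *\<^sub>R \<mu>) = monom_pt \<alpha> v \<mu> powi n"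
proof -
  have prod_powi: "(\<Prod>i\<in>A. f i) powi n = (\<Prod>i\<in>A. f i powi n)" for A :: "'r set" and f :: "'r \<Rightarrow> 'r ratfun"
    by (induction A rule: infinite_finite_induct) (auto simp: power_int_mult_distrib)
  have "v i powi (n * root_coord \<alpha> \<mu> i) = (v i powi root_coord \<alpha> \<mu> i) powi n" for i
    by (subst mult.commute) (rule power_int_mult)
  then show ?thesis
    using assms by (simp add: monom_pt_def lattice_scale prod_powi)
qed

lemma monom_0: "monom_pt \<alpha> v 0 = 1"
  using monom_scale[OF lattice_0, of v 0] by simp

lemma monom_simple: "monom_pt \<alpha> v (\<alpha> i) = v i"
proof -
  have "monom_pt \<alpha> v (\<alpha> i) = (\<Prod>j\<in>UNIV. if j = i then v j else 1)"
    unfolding monom_pt_def by (intro prod.cong) (auto simp: root_coord_simple)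
  then show ?thesis by simp
qed

lemma monom_lincomb:
  assumes "\<And>i. v i \<noteq> 0" "\<And>j. j \<in> I \<Longrightarrow> m j \<in> root_lattice \<alpha>" "finite I"
  shows "monom_pt \<alpha> v (\<Sum>j\<in>I. of_int (k j) *\<^sub>R m j) = (\<Prod>j\<in>I. monom_pt \<alpha> v (m j) powi k j)"
  using assms(3,2)
proof (induction I rule: finite_induct)
  case empty
  then show ?case by (simp add: monom_0)
next
  case (insert j I)
  then show ?case
    using lattice_lincomb(1)[of I m k] assms(1)
    by (simp add: monom_add monom_scale lattice_scale)
qed

lemma xpow_nonzero [simp]: "xpow \<mu> \<noteq> 0"
  by (rule monom_nonzero) simp

lemma rf_val_xpow: "\<mu> \<in> root_lattice \<alpha> \<Longrightarrow> rf_val (wt z) (xpow \<mu>) = z \<bullet> \<mu>"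
proof -
  assume \<mu>: "\<mu> \<in> root_lattice \<alpha>"
  have "rf_val (wt z) (xpow \<mu>) = (\<Sum>i\<in>UNIV. of_int (root_coord \<alpha> \<mu> i) * (z \<bullet> \<alpha> i))"
    by (simp add: monom_pt_def rf_val_prod rf_val_powi)
  also have "\<dots> = z \<bullet> (\<Sum>i\<in>UNIV. of_int (root_coord \<alpha> \<mu> i) *\<^sub>R \<alpha> i)"
    by (simp add: inner_sum_right)
  finally show ?thesis using \<mu> by (simp add: lattice_expansion)
qed

text \<open>
  Monomials with distinct exponents cannot cancel. Multiplying by a high power of the product of all
  variables makes every exponent nonnegative, and then the claim is about the keys of a polynomial.
  The sum runs over an abstract index set so that it applies to images of monomials under
  substitutions.
\<close>
lemma laurent_val_le:
  assumes I: "finite I" and e: "inj_on e I" "e ` I \<subseteq> root_lattice \<alpha>"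
    and c: "\<And>i. i \<in> I \<Longrightarrow> c i \<noteq> 0" and j: "j \<in> I"
  shows "(\<Sum>i\<in>I. rf_const (c i) * xpow (e i)) \<noteq> 0" (is "?g \<noteq> 0")
    and "rf_val (wt z) (\<Sum>i\<in>I. rf_const (c i) * xpow (e i)) \<le> z \<bullet> e j"
proof -
  \<comment> \<open>any common bound for the absolute values of the exponents\<close>
  define K :: nat where "K = (\<Sum>i\<in>I. \<Sum>k\<in>UNIV. nat \<bar>root_coord \<alpha> (e i) k\<bar>)"
  have K: "0 \<le> root_coord \<alpha> (e i) k + int K" if "i \<in> I" for i k
  proof -
    have "nat \<bar>root_coord \<alpha> (e i) k\<bar> \<le> (\<Sum>k\<in>UNIV. nat \<bar>root_coord \<alpha> (e i) k\<bar>)"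
      by (intro member_le_sum) auto
    also have "\<dots> \<le> K"
      unfolding K_def using I that by (intro member_le_sum) auto
    finally show ?thesis by linarith
  qed
  define d where "d i = (Abs_poly_mapping (\<lambda>k. nat (root_coord \<alpha> (e i) k + int K)) :: 'r \<Rightarrow>\<^sub>0 nat)" for i
  have lookup_d: "Poly_Mapping.lookup (d i) k = nat (root_coord \<alpha> (e i) k + int K)" for i k
    by (simp add: d_def)
  define X :: "'r ratfun" where "X = (\<Prod>k\<in>UNIV. rf_var k ^ K)"
  have X0: "X \<noteq> 0" by (simp add: X_def)
  have inj_d: "i = j" if "i \<in> I" "j \<in> I" "d i = d j" for i j
  proof -
    have "root_coord \<alpha> (e i) k = root_coord \<alpha> (e j) k" for k
      using K[OF that(1), of k] K[OF that(2), of k] that(3) by (metis lookup_d nat_eq_iff2 add_right_cancel)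
    then have coords: "root_coord \<alpha> (e i) = root_coord \<alpha> (e j)" by blast
    have "e i \<in> root_lattice \<alpha>" "e j \<in> root_lattice \<alpha>"
      using e(2) that by auto
    then have "e i = e j"
      by (metis lattice_expansion coords)
    then show ?thesis using e(1) that by (auto dest: inj_onD)
  qed
  have rf_monomial: "Fraction_Field.Fract (Poly_Mapping.single k 1) 1 =
      (\<Prod>i\<in>UNIV. rf_var i ^ Poly_Mapping.lookup k i)" for k :: "'r \<Rightarrow>\<^sub>0 nat"
  proof -
    have power: "rf_var i ^ n = Fraction_Field.Fract (Poly_Mapping.single (Poly_Mapping.single i n) 1) 1" for i :: 'r and n
      by (induction n) (auto simp: rf_var_def fract_collapse mult_single simp flip: single_add)
    have prod: "(\<Prod>i\<in>A. Fraction_Field.Fract (Poly_Mapping.single (h i) 1) 1)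
        = Fraction_Field.Fract (Poly_Mapping.single (\<Sum>i\<in>A. h i) (1::complex)) 1" for A and h :: "'r \<Rightarrow> ('r \<Rightarrow>\<^sub>0 nat)"
      by (induction A rule: infinite_finite_induct) (auto simp: fract_collapse mult_single)
    have "(\<Sum>i\<in>UNIV. Poly_Mapping.single i (Poly_Mapping.lookup k i)) = k"
      by (rule poly_mapping_eqI) (simp add: lookup_sum lookup_single when_def)
    then show ?thesis by (simp add: power prod)
  qed
  define P where "P = (\<Sum>i\<in>I. Poly_Mapping.single (d i) (c i))"
  have shifted: "X * (rf_const (c i) * xpow (e i)) = Fraction_Field.Fract (Poly_Mapping.single (d i) (c i)) 1"
    if "i \<in> I" for i
  proof -
    have "X * xpow (e i) = (\<Prod>k\<in>UNIV. rf_var k ^ Poly_Mapping.lookup (d i) k)"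
      unfolding X_def monom_pt_def prod.distrib[symmetric]
    proof (rule prod.cong[OF HOL.refl])
      fix k
      have "rf_var k ^ K * rf_var k powi root_coord \<alpha> (e i) k
          = rf_var k powi (int K + root_coord \<alpha> (e i) k)"
        by (simp add: power_int_add)
      also have "\<dots> = rf_var k powi int (Poly_Mapping.lookup (d i) k)"
        using K[OF that, of k] by (simp add: lookup_d add.commute)
      finally show "rf_var k ^ K * rf_var k powi root_coord \<alpha> (e i) k
          = rf_var k ^ Poly_Mapping.lookup (d i) k" by simp
    qed
    then have "X * xpow (e i) = Fraction_Field.Fract (Poly_Mapping.single (d i) 1) 1"
      by (simp add: rf_monomial)
    then have "rf_const (c i) * (X * xpow (e i)) = Fraction_Field.Fract (Poly_Mapping.single (d i) (c i)) 1"
      by (simp add: rf_const_def mult_single)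
    then show ?thesis by (simp add: mult_ac)
  qed
  have Fract_sum: "(\<Sum>i\<in>A. Fraction_Field.Fract (h i) 1) = Fraction_Field.Fract (\<Sum>i\<in>A. h i) 1"
    for A and h :: "'c \<Rightarrow> (('r \<Rightarrow>\<^sub>0 nat) \<Rightarrow>\<^sub>0 complex)"
    by (induction A rule: infinite_finite_induct) (auto simp: fract_collapse)
  have XP: "X * ?g = Fraction_Field.Fract P 1"
    by (simp add: sum_distrib_left shifted Fract_sum P_def)
  have "Poly_Mapping.lookup P (d j) = (\<Sum>i\<in>I. if i = j then c i else 0)"
    unfolding P_def lookup_sum lookup_single using inj_d j
    by (intro sum.cong) (auto simp: when_def)
  then have Pj: "Poly_Mapping.lookup P (d j) = c j"
    using I j by simp
  then have P: "P \<noteq> 0" "d j \<in> Poly_Mapping.keys P"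
    using c[OF j] by (auto simp: in_keys_iff)
  show g0: "?g \<noteq> 0"
    using XP P(1) by (auto simp: Fract_eq_0_iff dest: sym)
  have "real (nat (root_coord \<alpha> (e j) k + int K)) = of_int (root_coord \<alpha> (e j) k) + real K" for k
    using K[OF j, of k] by simp
  then have "exp_weight (wt z) (d j) = (\<Sum>k\<in>UNIV. (of_int (root_coord \<alpha> (e j) k) + real K) * (z \<bullet> \<alpha> k))"
    by (simp add: exp_weight_def lookup_d)
  also have "\<dots> = z \<bullet> (\<Sum>k\<in>UNIV. of_int (root_coord \<alpha> (e j) k) *\<^sub>R \<alpha> k) + (\<Sum>k\<in>UNIV. real K * (z \<bullet> \<alpha> k))"
    by (simp add: algebra_simps sum.distrib inner_sum_right)
  also have "(\<Sum>k\<in>UNIV. of_int (root_coord \<alpha> (e j) k) *\<^sub>R \<alpha> k) = e j"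
    using e(2) j by (intro lattice_expansion) auto
  also have "(\<Sum>k\<in>UNIV. real K * (z \<bullet> \<alpha> k)) = rf_val (wt z) X"
    by (simp add: X_def rf_val_prod rf_val_power)
  finally have "exp_weight (wt z) (d j) = z \<bullet> e j + rf_val (wt z) X" .
  moreover have "rf_val (wt z) X + rf_val (wt z) ?g = poly_val (wt z) P"
    using rf_val_mult[OF X0 g0, of "wt z"] XP P(1) by (simp add: rf_val_Fract)
  ultimately show "rf_val (wt z) ?g \<le> z \<bullet> e j"
    using poly_val_le[OF P(2), of "wt z"] by simp
qed

lemma laurent_val_ge:
  assumes "\<And>i. i \<in> I \<Longrightarrow> e i \<in> root_lattice \<alpha>" "\<And>i. i \<in> I \<Longrightarrow> b \<le> z \<bullet> e i"
  shows "val_ge (wt z) b (\<Sum>i\<in>I. rf_const (c i) * xpow (e i))"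
  using assms by (intro val_ge_sum val_ge_const_mult) (auto simp: val_ge_def rf_val_xpow)

text \<open>
  The case of two exponents. The exact value is needed since binomials occur in denominators.
\<close>
lemma binomial_val:
  assumes "c \<noteq> 0" "\<mu> \<in> root_lattice \<alpha>" "\<mu> \<noteq> 0"
  shows "1 - rf_const c * xpow \<mu> \<noteq> 0"
    and "rf_val (wt z) (1 - rf_const c * xpow \<mu>) = min 0 (z \<bullet> \<mu>)"
proof -
  define e where "e b = (if b then \<mu> else 0)" for b
  define a where "a b = (if b then - c else 1)" for b
  have eq: "(\<Sum>b\<in>UNIV. rf_const (a b) * xpow (e b)) = 1 - rf_const c * xpow \<mu>"
    by (simp add: UNIV_bool a_def e_def monom_0 rf_const_uminus)
  have e: "inj_on e UNIV" "e ` UNIV \<subseteq> root_lattice \<alpha>" and a: "\<And>b. a b \<noteq> 0"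
    using assms lattice_0 by (auto simp: inj_on_def e_def a_def)
  note le = laurent_val_le[where I = UNIV and e = e and c = a, OF finite_class.finite_UNIV e a UNIV_I, unfolded eq]
  show nz: "1 - rf_const c * xpow \<mu> \<noteq> 0"
    by (rule le(1))
  have "val_ge (wt z) (min 0 (z \<bullet> \<mu>)) (1 - rf_const c * xpow \<mu>)"
    unfolding eq[symmetric] using e(2) by (intro laurent_val_ge) (auto simp: e_def)
  moreover have "rf_val (wt z) (1 - rf_const c * xpow \<mu>) \<le> min 0 (z \<bullet> \<mu>)"
    using le(2)[of z True] le(2)[of z False] by (simp add: e_def)
  ultimately show "rf_val (wt z) (1 - rf_const c * xpow \<mu>) = min 0 (z \<bullet> \<mu>)"
    using nz by (simp add: val_ge_def)
qed

text \<open>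
  The points at which rational functions get evaluated. Up to nonzero constants, evaluation at such a
  point acts on exponents as the linear map \<open>s\<close>.
\<close>
definition monomial_pt :: "('a \<Rightarrow> 'a) \<Rightarrow> ('r \<Rightarrow> 'r ratfun) \<Rightarrow> bool" where
  "monomial_pt s v \<longleftrightarrow> (\<forall>i. \<exists>c. c \<noteq> 0 \<and> v i = rf_const c * xpow (s (\<alpha> i)))"

lemma monom_monomial_pt:
  assumes v: "monomial_pt s v" and s: "s \<in> weyl_group \<Phi>" and \<mu>: "\<mu> \<in> root_lattice \<alpha>"
  shows "\<exists>c. c \<noteq> 0 \<and> monom_pt \<alpha> v \<mu> = rf_const c * xpow (s \<mu>)"
proof -
  obtain c where c: "\<And>i. c i \<noteq> 0 \<and> v i = rf_const (c i) * xpow (s (\<alpha> i))"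
    using v unfolding monomial_pt_def by metis
  define n where "n = root_coord \<alpha> \<mu>"
  have "monom_pt \<alpha> v \<mu> = (\<Prod>i\<in>UNIV. (rf_const (c i) * xpow (s (\<alpha> i))) powi n i)"
    using c by (simp add: monom_pt_def n_def)
  also have "\<dots> = rf_const (\<Prod>i\<in>UNIV. c i powi n i) * (\<Prod>i\<in>UNIV. xpow (s (\<alpha> i)) powi n i)"
    by (simp add: power_int_mult_distrib prod.distrib rf_const_prod rf_const_powi)
  also have "(\<Prod>i\<in>UNIV. xpow (s (\<alpha> i)) powi n i) = xpow (\<Sum>i\<in>UNIV. of_int (n i) *\<^sub>R s (\<alpha> i))"
    by (rule monom_lincomb[symmetric])
       (auto simp: weyl_group_lattice[OF s] simple_root_in_lattice)
  also have "(\<Sum>i\<in>UNIV. of_int (n i) *\<^sub>R s (\<alpha> i)) = s (\<Sum>i\<in>UNIV. of_int (n i) *\<^sub>R \<alpha> i)"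
    by (simp add: linear_sum[OF weyl_group_linear[OF s]] linear_scale[OF weyl_group_linear[OF s]])
  also have "(\<Sum>i\<in>UNIV. of_int (n i) *\<^sub>R \<alpha> i) = \<mu>"
    unfolding n_def by (rule lattice_expansion[OF \<mu>])
  finally have "monom_pt \<alpha> v \<mu> = rf_const (\<Prod>i\<in>UNIV. c i powi n i) * xpow (s \<mu>)" .
  moreover have "(\<Prod>i\<in>UNIV. c i powi n i) \<noteq> 0"
    using c by simp
  ultimately show ?thesis by blast
qed

text \<open>
  An injective \<open>s\<close> keeps distinct exponents distinct, so the image of a polynomial is a Laurent
  polynomial with the transported exponents and no cancellation.
\<close>
lemma poly_eval_val:
  assumes v: "monomial_pt s v" and s: "s \<in> weyl_group \<Phi>"
    and u: "\<And>i. u i = z \<bullet> s (\<alpha> i)" and p: "p \<noteq> 0"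
  shows "poly_eval v p \<noteq> 0" and "rf_val (wt z) (poly_eval v p) = poly_val u p"
proof -
  define e where "e k = (\<Sum>i\<in>UNIV. of_int (int (Poly_Mapping.lookup k i)) *\<^sub>R \<alpha> i)" for k :: "'r \<Rightarrow>\<^sub>0 nat"
  have e_lattice: "e k \<in> root_lattice \<alpha>" and e_coord: "root_coord \<alpha> (e k) = (\<lambda>i. int (Poly_Mapping.lookup k i))" for k
    using root_latticeI root_coord_eqI by (simp_all only: e_def)
  have "inj e"
  proof (rule injI)
    fix k m assume "e k = e m"
    then have "int (Poly_Mapping.lookup k i) = int (Poly_Mapping.lookup m i)" for i
      using e_coord by metis
    then show "k = m" by (intro poly_mapping_eqI) simp
  qed
  then have inj: "inj_on (s \<circ> e) (Poly_Mapping.keys p)"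
    using weyl_group_inj[OF s] by (intro inj_on_subset[OF inj_compose]) auto
  have "\<exists>c. c \<noteq> 0 \<and> monom_pt \<alpha> v (e k) = rf_const c * xpow (s (e k))" for k
    by (rule monom_monomial_pt[OF v s e_lattice])
  then obtain c where c: "\<And>k. c k \<noteq> 0" "\<And>k. monom_pt \<alpha> v (e k) = rf_const (c k) * xpow (s (e k))"
    by metis
  have eq: "poly_eval v p = (\<Sum>k\<in>Poly_Mapping.keys p. rf_const (Poly_Mapping.lookup p k * c k) * xpow ((s \<circ> e) k))"
    unfolding poly_eval_def
  proof (rule sum.cong[OF HOL.refl])
    fix k
    have "(\<Prod>i\<in>UNIV. v i ^ Poly_Mapping.lookup k i) = monom_pt \<alpha> v (e k)"
      by (simp add: monom_pt_def e_coord)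
    then show "rf_const (Poly_Mapping.lookup p k) * (\<Prod>i\<in>UNIV. v i ^ Poly_Mapping.lookup k i)
        = rf_const (Poly_Mapping.lookup p k * c k) * xpow ((s \<circ> e) k)"
      by (simp add: c rf_const_mult)
  qed
  have weight: "exp_weight u k = z \<bullet> (s \<circ> e) k" for k
    by (simp add: exp_weight_def u e_def linear_sum[OF weyl_group_linear[OF s]]
        linear_scale[OF weyl_group_linear[OF s]] inner_sum_right)
  have lattice: "(s \<circ> e) ` Poly_Mapping.keys p \<subseteq> root_lattice \<alpha>"
    using weyl_group_lattice[OF s e_lattice] by auto
  obtain k where k: "k \<in> Poly_Mapping.keys p" "exp_weight u k = poly_val u p"
    using poly_val_attained[OF p] .
  note le = laurent_val_le[OF finite_keys inj lattice _ k(1),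
      of "\<lambda>k. Poly_Mapping.lookup p k * c k", folded eq]
  show nz: "poly_eval v p \<noteq> 0"
    by (rule le(1)) (simp add: c in_keys_iff)
  have "rf_val (wt z) (poly_eval v p) \<le> z \<bullet> (s \<circ> e) k"
    by (rule le(2)) (simp add: c in_keys_iff)
  moreover have "val_ge (wt z) (poly_val u p) (poly_eval v p)"
    unfolding eq
  proof (rule laurent_val_ge)
    fix k assume k: "k \<in> Poly_Mapping.keys p"
    then show "(s \<circ> e) k \<in> root_lattice \<alpha>" using lattice by blast
    show "poly_val u p \<le> z \<bullet> (s \<circ> e) k" using poly_val_le[OF k, of u] weight by simp
  qed
  ultimately show "rf_val (wt z) (poly_eval v p) = poly_val u p"
    using nz k(2) weight by (simp add: val_ge_def)
qed

text \<open>
  Numerator and denominator are transported separately, so the bound holds for whichever fraction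
  the evaluation selects.
\<close>
lemma rf_eval_val_ge:
  assumes v: "monomial_pt s v" and s: "s \<in> weyl_group \<Phi>"
    and u: "\<And>i. u i = z \<bullet> s (\<alpha> i)" and f: "val_ge u b f"
  shows "val_ge (wt z) b (rf_eval v f)"
proof -
  define ab where "ab = (SOME (a, b). b \<noteq> 0 \<and> f = Fraction_Field.Fract a b)"
  obtain p r where pr: "ab = (p, r)" by force
  have "\<exists>ab. case ab of (a, b) \<Rightarrow> b \<noteq> 0 \<and> f = Fraction_Field.Fract a b"
    by (cases f) auto
  then have "case ab of (a, b) \<Rightarrow> b \<noteq> 0 \<and> f = Fraction_Field.Fract a b"
    unfolding ab_def by (rule someI_ex)
  then have r: "r \<noteq> 0" and fr: "f = Fraction_Field.Fract p r" by (auto simp: pr)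
  have eval: "rf_eval v f = poly_eval v p / poly_eval v r"
    unfolding rf_eval_def ab_def[symmetric] by (simp add: pr)
  show ?thesis
  proof (cases "p = 0")
    case True
    then show ?thesis by (simp add: eval poly_eval_def)
  next
    case False
    have "f \<noteq> 0" using False r by (simp add: fr Fract_eq_0_iff)
    then have "b \<le> poly_val u p - poly_val u r"
      using f False r by (simp add: val_ge_def fr rf_val_Fract)
    also have "\<dots> = rf_val (wt z) (rf_eval v f)"
      using poly_eval_val[OF v s u False] poly_eval_val[OF v s u r]
      by (simp add: eval divide_inverse rf_val_mult rf_val_inverse)
    finally show ?thesis by (simp add: val_ge_def)
  qed
qed

section \<open>Valuation of the slash action\<close>

lemma monomial_pt_var: "monomial_pt id rf_var"
  unfolding monomial_pt_def by (auto simp: monom_simple intro!: exI[of _ 1])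

lemma monomial_pt_epsilon: "monomial_pt id (epsilon_pt \<alpha> i rf_var)"
  unfolding monomial_pt_def
proof
  fix j
  show "\<exists>c. c \<noteq> 0 \<and> epsilon_pt \<alpha> i rf_var j = rf_const c * xpow (id (\<alpha> j))"
    by (rule exI[of _ "if adjacent \<alpha> i j then -1 else 1"])
       (simp add: epsilon_pt_def monom_simple rf_const_uminus)
qed

lemma sqrt_q_nonzero: "complex_of_real (sqrt (real q)) \<noteq> 0"
  using q_pos by simp

lemma monomial_pt_sigma:
  assumes v: "monomial_pt s v" and s: "s \<in> weyl_group \<Phi>"
  shows "monomial_pt (s \<circ> simple_refl i) (sigma_pt q \<alpha> i v)"
  unfolding monomial_pt_def
proof
  fix j
  obtain c where c: "\<And>i. c i \<noteq> 0" "\<And>i. v i = rf_const (c i) * xpow (s (\<alpha> i))"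
    using v unfolding monomial_pt_def by metis
  note lin = linear_add[OF weyl_group_linear[OF s]] linear_neg[OF weyl_group_linear[OF s]]
  have lattice: "s (\<alpha> j) \<in> root_lattice \<alpha>" for j
    by (rule weyl_group_lattice[OF s simple_root_in_lattice])
  consider "adjacent \<alpha> i j" | "\<not> adjacent \<alpha> i j" "j = i" | "\<not> adjacent \<alpha> i j" "j \<noteq> i"
    by blast
  then show "\<exists>c. c \<noteq> 0 \<and> sigma_pt q \<alpha> i v j = rf_const c * xpow ((s \<circ> simple_refl i) (\<alpha> j))"
  proof cases
    case 1
    then have "sigma_pt q \<alpha> i v j
        = rf_const (c i * c j * complex_of_real (sqrt (real q))) * xpow ((s \<circ> simple_refl i) (\<alpha> j))"
      by (simp add: sigma_pt_def rf_sqrt_q_def c(2) simple_refl_simple_root lin monom_add lattice rf_const_mult)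
    then show ?thesis
      using c(1) sqrt_q_nonzero by (metis mult_eq_0_iff)
  next
    case 2
    have "xpow (- s (\<alpha> i)) = inverse (xpow (s (\<alpha> i)))"
      using monom_scale[OF lattice, of rf_var "-1" i] by simp
    then have "sigma_pt q \<alpha> i v j
        = rf_const (inverse (of_nat q * c i)) * xpow ((s \<circ> simple_refl i) (\<alpha> j))"
      using 2 by (simp add: sigma_pt_def rf_q_def c(2) simple_refl_simple_root lin rf_const_mult
          rf_const_inverse divide_inverse)
    then show ?thesis
      using c(1) q_pos by (metis inverse_nonzero_iff_nonzero mult_eq_0_iff of_nat_eq_0_iff less_irrefl)
  next
    case 3
    then have "sigma_pt q \<alpha> i v j = rf_const (c j) * xpow ((s \<circ> simple_refl i) (\<alpha> j))"
      by (simp add: sigma_pt_def c(2) simple_refl_simple_root)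
    then show ?thesis using c(1) by blast
  qed
qed

text \<open>
  The inverse of the element that the word represents. It describes the exponents in \<open>w x\<close>, as
  substitutions compose contravariantly.
\<close>
definition word_inv :: "'r list \<Rightarrow> 'a \<Rightarrow> 'a" where
  "word_inv is = foldr (\<lambda>i s. s \<circ> simple_refl i) is id"

lemma word_inv_Nil: "word_inv [] = id" and word_inv_Cons: "word_inv (i # is) = word_inv is \<circ> simple_refl i"
  by (simp_all add: word_inv_def)

lemma word_inv_snoc: "word_inv (is @ [i]) = simple_refl i \<circ> word_inv is"
  by (induction "is") (simp_all add: word_inv_Nil word_inv_Cons comp_assoc)

lemma word_inv_weyl: "word_inv is \<in> weyl_group \<Phi>"
  by (induction "is")
     (simp_all only: word_inv_Nil word_inv_Cons weyl_group.one weyl_group_comp_reflection simple_root)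

lemma monomial_pt_word: "monomial_pt (word_inv is) (foldr (sigma_pt q \<alpha>) is rf_var)"
proof (induction "is")
  case Nil
  show ?case using monomial_pt_var by (simp add: word_inv_Nil id_def)
next
  case (Cons i "is")
  show ?case
    using monomial_pt_sigma[OF Cons.IH word_inv_weyl] by (simp add: word_inv_Cons comp_def)
qed

lemma rf_plus_minus_val_ge:
  assumes "val_ge (wt z) b f"
  shows "val_ge (wt z) b (rf_plus \<alpha> l i f)" "val_ge (wt z) b (rf_minus \<alpha> l i f)"
proof -
  let ?e = "rf_eval (epsilon_pt \<alpha> i rf_var) f"
  have e: "val_ge (wt z) b ?e"
    by (rule rf_eval_val_ge[OF monomial_pt_epsilon weyl_group.one _ assms]) simp
  have "(2 :: 'r ratfun) = rf_const 2"
    using rf_const_add[of 1 1] by simp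
  then have half: "g / 2 = rf_const (inverse 2) * g" for g :: "'r ratfun"
    by (simp only: rf_const_inverse divide_inverse mult.commute)
  have sign: "((-1) ^ l i :: 'r ratfun) = rf_const ((-1) ^ l i)"
    by (simp add: rf_const_power rf_const_uminus)
  have "rf_plus \<alpha> l i f = rf_const (inverse 2) * (f + rf_const ((-1) ^ l i) * ?e)"
    unfolding rf_plus_def sign half ..
  then show "val_ge (wt z) b (rf_plus \<alpha> l i f)"
    using assms e by (auto intro!: val_ge_const_mult val_ge_add)
  have "rf_minus \<alpha> l i f = rf_const (inverse 2) * (f + rf_const (- ((-1) ^ l i)) * ?e)"
    unfolding rf_minus_def sign half by (simp add: rf_const_uminus)
  then show "val_ge (wt z) b (rf_minus \<alpha> l i f)"
    using assms e by (auto intro!: val_ge_const_mult val_ge_add)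
qed

text \<open>
  Both prefactors have valuation \<open>- (z \<bullet> \<alpha>\<^sub>i)\<close>: in the first one \<open>1 - q x\<^sub>i\<close> and \<open>1 - x\<^sub>i\<close>
  contribute the same amount. The power of \<open>x\<^sub>i\<close> adds \<open>l\<^sub>i (z \<bullet> \<alpha>\<^sub>i)\<close>, and the substitution moves
  the reflection from the exponents to \<open>z\<close>.
\<close>
lemma slash_simple_val_ge:
  assumes f: "val_ge (wt (simple_refl i z)) b f"
  shows "val_ge (wt z) (b + (real (l i) - 1) * (z \<bullet> \<alpha> i)) (slash_simple q \<alpha> l f i)"
proof -
  let ?t = "z \<bullet> \<alpha> i" and ?v = "sigma_pt q \<alpha> i rf_var"
  define x where "x = (rf_var i :: 'r ratfun)"
  define sq where "sq = (rf_sqrt_q q :: 'r ratfun)"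
  define Q where "Q = (rf_q q :: 'r ratfun)"
  have mono: "monomial_pt (simple_refl i) ?v"
    using monomial_pt_sigma[OF monomial_pt_var weyl_group.one, of i] by simp
  have weyl: "simple_refl i \<in> weyl_group \<Phi>"
    using weyl_group.refl[OF simple_root weyl_group.one] by simp
  have subst: "val_ge (wt z) b (rf_eval ?v g)" if "val_ge (wt (simple_refl i z)) b g" for g
    by (rule rf_eval_val_ge[OF mono weyl _ that]) (simp add: reflection_adjoint simple_root)
  have x: "x \<noteq> 0" "rf_val (wt z) x = ?t" and sq: "sq \<noteq> 0" "rf_val (wt z) sq = 0"
    and Q: "Q \<noteq> 0" "rf_val (wt z) Q = 0"
    using sqrt_q_nonzero q_pos by (simp_all add: x_def sq_def Q_def rf_sqrt_q_def rf_q_def)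
  have \<alpha>0: "\<alpha> i \<noteq> 0" using simple_root zero_not_root by metis
  have bin: "1 - Q * x \<noteq> 0" "rf_val (wt z) (1 - Q * x) = min 0 ?t"
      "1 - x \<noteq> 0" "rf_val (wt z) (1 - x) = min 0 ?t"
    using binomial_val[OF _ simple_root_in_lattice \<alpha>0, of "of_nat q"]
      binomial_val[OF _ simple_root_in_lattice \<alpha>0, of 1] q_pos
    by (simp_all add: Q_def x_def rf_q_def monom_simple)
  have A: "val_ge (wt z) (- ?t) (- ((1 - Q * x) / (Q * x * (1 - x))))"
  proof -
    have "val_ge (wt z) (- ?t) ((1 - Q * x) / (Q * x * (1 - x)))"
      using x Q bin by (simp add: val_ge_def divide_inverse rf_val_mult rf_val_inverse)
    then show ?thesis
      using val_ge_const_mult[of "wt z" "- ?t" _ "-1"] by (simp add: rf_const_uminus)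
  qed
  have B: "val_ge (wt z) (- ?t) (1 / (x * sq))"
    using x sq by (simp add: val_ge_def divide_inverse rf_val_mult rf_val_inverse)
  have P: "val_ge (wt z) (real (l i) * ?t) ((x * sq) ^ l i)"
    using x sq by (simp add: val_ge_def rf_val_power rf_val_mult)
  have "val_ge (wt z) (- ?t + real (l i) * ?t + b) (slash_simple q \<alpha> l f i)"
    unfolding slash_simple_def x_def[symmetric] sq_def[symmetric] Q_def[symmetric]
    by (intro val_ge_add val_ge_mult A B P subst rf_plus_minus_val_ge f)
  then show ?thesis by (simp add: algebra_simps)
qed

text \<open>
  This is \<open>\<tau> = \<theta> - 2\<rho>\<close>, chosen so that \<open>\<tau> - \<sigma>\<^sub>i \<tau> = (l\<^sub>i - 1) \<alpha>\<^sub>i\<close> expresses the shift caused by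
  one slash operator as a coboundary.
\<close>
abbreviation shifted_weight :: 'a where
  "shifted_weight \<equiv> (\<Sum>k\<in>UNIV. real (l k) *\<^sub>R fund_weight \<alpha> k) - rho \<Phi> \<alpha>"

lemma simple_refl_shifted_weight:
  "simple_refl i shifted_weight = shifted_weight - (real (l i) - 1) *\<^sub>R \<alpha> i"
proof -
  have "(\<Sum>k\<in>UNIV. real (l k) *\<^sub>R fund_weight \<alpha> k) \<bullet> \<alpha> i = (\<Sum>k\<in>UNIV. if i = k then real (l k) else 0)"
    unfolding inner_sum_left by (intro sum.cong) (auto simp: fund_weight_inner)
  then have "shifted_weight \<bullet> \<alpha> i = real (l i) - 1"
    by (simp add: inner_diff_left rho_simple)
  then show ?thesis by (simp add: reflection_eq simple_root)
qed

text \<open>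
  Induction on the last letter, with \<open>z\<close> generalized because the induction hypothesis is applied to
  the reflected vector. The bounds telescope as \<open>(\<tau> - \<sigma>\<^sub>i \<tau>) + \<sigma>\<^sub>i (\<tau> - s \<tau>) = \<tau> - \<sigma>\<^sub>i s \<tau>\<close>.
\<close>
lemma slash_word_val_ge:
  "val_ge (wt z) (z \<bullet> (shifted_weight - word_inv is shifted_weight)) (foldl (slash_simple q \<alpha> l) 1 is)"
proof (induction "is" arbitrary: z rule: rev_induct)
  case Nil
  then show ?case by (simp add: word_inv_Nil val_ge_1)
next
  case (snoc i "is")
  let ?\<tau> = shifted_weight and ?s = "word_inv is"
  have "simple_refl i z \<bullet> (?\<tau> - ?s ?\<tau>) + (real (l i) - 1) * (z \<bullet> \<alpha> i)
      = z \<bullet> (simple_refl i ?\<tau> - simple_refl i (?s ?\<tau>)) + (real (l i) - 1) * (z \<bullet> \<alpha> i)"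
    by (simp only: reflection_adjoint simple_root linear_diff[OF linear_reflection])
  also have "\<dots> = z \<bullet> (?\<tau> - simple_refl i (?s ?\<tau>))"
    unfolding simple_refl_shifted_weight by (simp add: inner_diff_right)
  finally show ?case
    using slash_simple_val_ge[OF snoc.IH[of "simple_refl i z"]] by (simp add: word_inv_snoc)
qed

section \<open>Valuation of the products over the positive roots\<close>

text \<open>
  Covers \<open>D\<close>, where \<open>s\<close> is the identity, and \<open>\<Delta>\<close> at the translated point.
\<close>
lemma binomial_product_val:
  fixes n :: "'a \<Rightarrow> int"
  assumes v: "monomial_pt s v" and s: "s \<in> weyl_group \<Phi>"
  defines "B \<equiv> (\<Prod>\<beta>\<in>pos_roots \<Phi> \<alpha>. 1 - rf_q q powi n \<beta> * monom_pt \<alpha> v (2 *\<^sub>R \<beta>))"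
  shows "B \<noteq> 0" and "rf_val (wt z) B = (\<Sum>\<beta>\<in>pos_roots \<Phi> \<alpha>. min 0 (2 * (z \<bullet> s \<beta>)))"
proof -
  have factor: "1 - rf_q q powi n \<beta> * monom_pt \<alpha> v (2 *\<^sub>R \<beta>) \<noteq> 0 \<and>
      rf_val (wt z) (1 - rf_q q powi n \<beta> * monom_pt \<alpha> v (2 *\<^sub>R \<beta>)) = min 0 (2 * (z \<bullet> s \<beta>))"
    if \<beta>: "\<beta> \<in> pos_roots \<Phi> \<alpha>" for \<beta>
  proof -
    have lattice: "2 *\<^sub>R \<beta> \<in> root_lattice \<alpha>"
      using lattice_scale(1)[OF pos_root_in_lattice[OF \<beta>], of 2] by simp
    obtain c where c: "c \<noteq> 0" "monom_pt \<alpha> v (2 *\<^sub>R \<beta>) = rf_const c * xpow (s (2 *\<^sub>R \<beta>))"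
      using monom_monomial_pt[OF v s lattice] by blast
    have eq: "rf_q q powi n \<beta> * monom_pt \<alpha> v (2 *\<^sub>R \<beta>)
        = rf_const (of_nat q powi n \<beta> * c) * xpow (s (2 *\<^sub>R \<beta>))"
      by (simp add: c rf_q_def rf_const_mult rf_const_powi)
    have "s \<beta> \<noteq> 0"
      using weyl_group_root[OF s] \<beta> pos_roots_subset zero_not_root by (metis subsetD)
    then have nz: "s (2 *\<^sub>R \<beta>) \<noteq> 0"
      by (simp add: linear_scale[OF weyl_group_linear[OF s]])
    have coeff: "of_nat q powi n \<beta> * c \<noteq> 0"
      using c q_pos by simp
    show ?thesis
      unfolding eq
      using binomial_val(1)[OF coeff weyl_group_lattice[OF s lattice] nz]
        binomial_val(2)[OF coeff weyl_group_lattice[OF s lattice] nz, of z]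
      by (simp add: linear_scale[OF weyl_group_linear[OF s]])
  qed
  show "B \<noteq> 0" unfolding B_def using factor finite_pos_roots by simp
  show "rf_val (wt z) B = (\<Sum>\<beta>\<in>pos_roots \<Phi> \<alpha>. min 0 (2 * (z \<bullet> s \<beta>)))"
    unfolding B_def using factor by (subst rf_val_prod) auto
qed

text \<open>
  An even function has half of its sum over all roots on the positive ones, and \<open>W\<close> permutes all
  roots.
\<close>
lemma sum_abs_weyl:
  assumes s: "s \<in> weyl_group \<Phi>"
  shows "(\<Sum>\<beta>\<in>pos_roots \<Phi> \<alpha>. \<bar>z \<bullet> s \<beta>\<bar>) = (\<Sum>\<beta>\<in>pos_roots \<Phi> \<alpha>. \<bar>z \<bullet> \<beta>\<bar>)"
proof -
  have half: "(\<Sum>\<beta>\<in>\<Phi>. h \<beta>) = 2 * (\<Sum>\<beta>\<in>pos_roots \<Phi> \<alpha>. h \<beta>)"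
    if "\<And>\<beta>. h (- \<beta>) = h \<beta>" for h :: "'a \<Rightarrow> real"
  proof -
    have "(\<Sum>\<beta>\<in>\<Phi>. h \<beta>) = (\<Sum>\<beta>\<in>pos_roots \<Phi> \<alpha>. h \<beta>) + (\<Sum>\<beta>\<in>uminus ` pos_roots \<Phi> \<alpha>. h \<beta>)"
      using neg_pos_root finite_pos_roots
      by (subst roots_eq_Un, subst sum.union_disjoint) auto
    also have "(\<Sum>\<beta>\<in>uminus ` pos_roots \<Phi> \<alpha>. h \<beta>) = (\<Sum>\<beta>\<in>pos_roots \<Phi> \<alpha>. h \<beta>)"
      by (subst sum.reindex) (auto simp: that)
    finally show ?thesis by simp
  qed
  have "inj_on s \<Phi>" using weyl_group_inj[OF s] by (rule inj_on_subset) auto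
  moreover have "s ` \<Phi> \<subseteq> \<Phi>" using weyl_group_root[OF s] by auto
  ultimately have "bij_betw s \<Phi> \<Phi>"
    using finite_roots by (simp add: bij_betw_def endo_inj_surj)
  then have "(\<Sum>\<beta>\<in>\<Phi>. \<bar>z \<bullet> s \<beta>\<bar>) = (\<Sum>\<beta>\<in>\<Phi>. \<bar>z \<bullet> \<beta>\<bar>)"
    by (rule sum.reindex_bij_betw)
  then show ?thesis
    using half[of "\<lambda>\<beta>. \<bar>z \<bullet> s \<beta>\<bar>"] half[of "\<lambda>\<beta>. \<bar>z \<bullet> \<beta>\<bar>"]
    by (simp add: linear_neg[OF weyl_group_linear[OF s]])
qed

lemma sum_min_weyl:
  assumes s: "s \<in> weyl_group \<Phi>"
  shows "(\<Sum>\<beta>\<in>pos_roots \<Phi> \<alpha>. min 0 (2 * (z \<bullet> s \<beta>)))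
       = 2 * (z \<bullet> s (rho \<Phi> \<alpha>)) - (\<Sum>\<beta>\<in>pos_roots \<Phi> \<alpha>. \<bar>z \<bullet> \<beta>\<bar>)"
proof -
  have "min 0 (2 * t) = t - \<bar>t\<bar>" for t :: real by auto
  then have "(\<Sum>\<beta>\<in>pos_roots \<Phi> \<alpha>. min 0 (2 * (z \<bullet> s \<beta>)))
      = (\<Sum>\<beta>\<in>pos_roots \<Phi> \<alpha>. z \<bullet> s \<beta>) - (\<Sum>\<beta>\<in>pos_roots \<Phi> \<alpha>. \<bar>z \<bullet> s \<beta>\<bar>)"
    by (simp add: sum_subtractf)
  also have "(\<Sum>\<beta>\<in>pos_roots \<Phi> \<alpha>. z \<bullet> s \<beta>) = 2 * (z \<bullet> s (rho \<Phi> \<alpha>))"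
    by (simp add: rho_def linear_scale[OF weyl_group_linear[OF s]]
        linear_sum[OF weyl_group_linear[OF s]] inner_sum_right)
  finally show ?thesis by (simp add: sum_abs_weyl[OF s])
qed

section \<open>The support of the numerator\<close>

abbreviation theta :: 'a where
  "theta \<equiv> rho \<Phi> \<alpha> + (\<Sum>k\<in>UNIV. real (l k) *\<^sub>R fund_weight \<alpha> k)"

text \<open>
  The factor \<open>D / \<Delta>(wx)\<close> contributes \<open>2 (z \<bullet> (\<rho> - s \<rho>))\<close>, which turns the bound with
  \<open>\<tau> = \<theta> - 2\<rho>\<close> for the slash action into one with \<open>\<theta>\<close>. Both bounds refer to the same \<open>s\<close> because
  both actions of \<open>w\<close> are evaluated along the same word.
\<close>
lemma N_summand_val_ge:
  fixes w :: "'a \<Rightarrow> 'a"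
  defines "s \<equiv> word_inv (weyl_word \<alpha> w)"
  shows "val_ge (wt z) (z \<bullet> (theta - s theta))
    (D_fun q \<Phi> \<alpha> * (inverse (Delta_pt q \<Phi> \<alpha> rf_var) * (j_fun q \<Phi> \<alpha> w * slash q \<alpha> l 1 w)))"
proof -
  let ?\<rho> = "rho \<Phi> \<alpha>"
  let ?S = "\<Sum>\<beta>\<in>pos_roots \<Phi> \<alpha>. \<bar>z \<bullet> \<beta>\<bar>"
  define D where "D = D_fun q \<Phi> \<alpha>"
  define E where "E = Delta_pt q \<Phi> \<alpha> rf_var"
  define E' where "E' = Delta_pt q \<Phi> \<alpha> (weyl_pt q \<alpha> w rf_var)"
  have s: "s \<in> weyl_group \<Phi>" by (simp add: s_def word_inv_weyl)
  note id = weyl_group.one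
  have D: "D \<noteq> 0" "rf_val (wt z) D = 2 * (z \<bullet> ?\<rho>) - ?S"
    using binomial_product_val[OF monomial_pt_var id] sum_min_weyl[OF id]
    by (simp_all add: D_def D_fun_def)
  have E: "E \<noteq> 0"
    using binomial_product_val(1)[OF monomial_pt_var id] by (simp add: E_def Delta_pt_def)
  have pt: "monomial_pt s (weyl_pt q \<alpha> w rf_var)"
    unfolding s_def weyl_pt_def by (rule monomial_pt_word)
  have E': "E' \<noteq> 0" "rf_val (wt z) E' = 2 * (z \<bullet> s ?\<rho>) - ?S"
    using binomial_product_val[OF pt s] sum_min_weyl[OF s]
    by (simp_all add: E'_def Delta_pt_def)
  have "val_ge (wt z) (2 * (z \<bullet> (?\<rho> - s ?\<rho>))) (D / E')"
    using D E' by (simp add: val_ge_def divide_inverse rf_val_mult rf_val_inverse inner_diff_right)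
  then have "val_ge (wt z) (2 * (z \<bullet> (?\<rho> - s ?\<rho>)) + z \<bullet> (shifted_weight - s shifted_weight))
      (D / E' * slash q \<alpha> l 1 w)"
    unfolding slash_def s_def by (rule val_ge_mult[OF _ slash_word_val_ge])
  also have "D / E' * slash q \<alpha> l 1 w = D * (inverse E * (j_fun q \<Phi> \<alpha> w * slash q \<alpha> l 1 w))"
    using E by (simp add: j_fun_def E_def[symmetric] E'_def[symmetric] field_simps)
  also have "2 * (z \<bullet> (?\<rho> - s ?\<rho>)) + z \<bullet> (shifted_weight - s shifted_weight) = z \<bullet> (theta - s theta)"
    by (simp add: linear_add[OF weyl_group_linear[OF s]] linear_diff[OF weyl_group_linear[OF s]]
        inner_diff_right inner_add_right)
  finally show ?thesis by (simp add: D_def E_def)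
qed

lemma N_fun_val_ge:
  assumes "\<And>w. w \<in> weyl_group \<Phi> \<Longrightarrow> b \<le> z \<bullet> (theta - w theta)"
  shows "val_ge (wt z) b (N_fun q \<Phi> \<alpha> l)"
proof -
  have "val_ge (wt z) b (\<Sum>w\<in>weyl_group \<Phi>. D_fun q \<Phi> \<alpha> *
      (inverse (Delta_pt q \<Phi> \<alpha> rf_var) * (j_fun q \<Phi> \<alpha> w * slash q \<alpha> l 1 w)))"
    by (rule val_ge_sum, rule val_ge_mono[OF N_summand_val_ge], rule assms[OF word_inv_weyl])
  then show ?thesis
    by (simp add: N_fun_def f_fun_def sum_distrib_left)
qed

text \<open>
  A support point outside the polytope could be strictly separated from it by a linear form, whose
  valuation would then be too small at \<open>N\<close>.
\<close>
lemma N_support_in_polytope: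
  assumes fin: "finite {\<mu> \<in> root_lattice \<alpha>. a \<mu> \<noteq> 0}"
    and N: "N_fun q \<Phi> \<alpha> l = (\<Sum>\<mu> \<in> {\<mu> \<in> root_lattice \<alpha>. a \<mu> \<noteq> 0}. rf_const (a \<mu>) * xpow \<mu>)"
  shows "{\<mu> \<in> root_lattice \<alpha>. a \<mu> \<noteq> 0} \<subseteq> weight_polytope \<Phi> theta"
proof
  let ?S = "{\<mu> \<in> root_lattice \<alpha>. a \<mu> \<noteq> 0}" and ?V = "{theta - w theta | w. w \<in> weyl_group \<Phi>}"
  fix \<mu> assume \<mu>: "\<mu> \<in> ?S"
  show "\<mu> \<in> weight_polytope \<Phi> theta"
  proof (rule ccontr)
    assume out: "\<mu> \<notin> weight_polytope \<Phi> theta"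
    have "finite ?V"
      using finite_imageI[OF finite_weyl_group, of "\<lambda>w. theta - w theta"]
      by (simp add: Setcompr_eq_image)
    then have "closed (weight_polytope \<Phi> theta)" "convex (weight_polytope \<Phi> theta)"
      unfolding weight_polytope_def
      by (auto intro: compact_imp_closed finite_imp_compact_convex_hull convex_convex_hull)
    then obtain z b where z: "z \<bullet> \<mu> < b" "\<And>x. x \<in> weight_polytope \<Phi> theta \<Longrightarrow> b < z \<bullet> x"
      using separating_hyperplane_closed_point[of "weight_polytope \<Phi> theta" \<mu>] out by blast
    have "b \<le> z \<bullet> (theta - w theta)" if "w \<in> weyl_group \<Phi>" for w
      using that by (intro less_imp_le z(2)) (auto simp: weight_polytope_def intro!: hull_inc)
    then have ge: "val_ge (wt z) b (N_fun q \<Phi> \<alpha> l)"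
      by (rule N_fun_val_ge)
    have "N_fun q \<Phi> \<alpha> l \<noteq> 0" "rf_val (wt z) (N_fun q \<Phi> \<alpha> l) \<le> z \<bullet> \<mu>"
      unfolding N by (rule laurent_val_le[OF fin _ _ _ \<mu>]; auto)+
    then show False using ge z(1) by (simp add: val_ge_def)
  qed
qed

end

theorem theorem3p2:
  fixes \<Phi> :: "'a::euclidean_space set"
    and \<alpha> :: "'r::{finite,linorder} \<Rightarrow> 'a"
    and q :: nat
    and l :: "'r \<Rightarrow> nat"
    and a :: "'a \<Rightarrow> complex"
    and \<theta> :: 'a
  assumes "root_system \<Phi>" and "reduced_roots \<Phi>" and "simply_laced \<Phi>" and "normalized_roots \<Phi>"
    and "simple_roots \<Phi> \<alpha>"
    and "primepow q"
    and "\<theta> = rho \<Phi> \<alpha> + (\<Sum>k\<in>UNIV. real (l k) *\<^sub>R fund_weight \<alpha> k)"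
    and "finite {\<mu> \<in> root_lattice \<alpha>. a \<mu> \<noteq> 0}"
    and "N_fun q \<Phi> \<alpha> l =
           (\<Sum>\<mu> \<in> {\<mu> \<in> root_lattice \<alpha>. a \<mu> \<noteq> 0}. rf_const (a \<mu>) * monom_pt \<alpha> rf_var \<mu>)"
  shows "{\<mu> \<in> root_lattice \<alpha>. a \<mu> \<noteq> 0} \<subseteq> weight_polytope \<Phi> \<theta>"
proof -
  interpret simply_laced_system \<Phi> \<alpha> q l
    using assms(1-6) by unfold_locales (auto dest: primepow_gt_0_nat)
  show ?thesis
    unfolding assms(7) by (rule N_support_in_polytope[OF assms(8,9)])
qed

end
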